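(* Let $k$ be a field of characteristic $\neq 2$ and $A$ a Hopf algebra over $k$ such that the only Hopf algebra morphism $A \to H_4$ is the trivial one. Then: (1) There exists a bijection between the set of types of Hopf algebra isomorphisms of all crossed products of Hopf algebras $A \# H_4$ and the quotient pointed set $\mathcal{Z}\mathcal{P}(A)/\equiv$, where $\equiv$ is the equivalence relation on $\mathcal{Z}\mathcal{P}(A)$ defined by: $a \equiv b$ if and only if there exists a pair $(u, \beta) \in \mathrm{Aut}_{\rm Hopf}(A) \times k^*$ such that $u(a) = \beta^{2} b$. Hence, $\mathrm{Crp}(H_4, A) \cong \mathcal{Z}\mathcal{P}(A)/\equiv$. (2) There exists a bijection $\mathcal{H}^{2}(H_4, A) \cong \mathcal{Z}\mathcal{P}(A)$.
   Context: $H_4$ is Sweedler's 4-dimensional Hopf algebra over $k$, with basis $\{1,g,x,gx\}$, relations $g^2=1$, $x^2=0$, $xg=-gx$, and $\Delta(g)=g\otimes g$, $\Delta(x)=x\otimes 1+g\otimes x$, $\varepsilon(g)=1$, $\varepsilon(x)=0$. The trivial Hopf algebra map $A\to H_4$ is $z\mapsto\varepsilon(z)1$. $\mathcal{Z}\mathcal{P}(A)=P(A)\cap Z(A)$, where $P(A)=\{z\in A\mid \Delta(z)=z\otimes 1+1\otimes z\}$ and $Z(A)$ is the center of $A$. $\mathrm{Aut}_{\rm Hopf}(A)$ is the group of Hopf algebra automorphisms of $A$. Sweedler notation is used. For Hopf algebras $A$, $H$, a weak action of $H$ on $A$ is a $k$-linear map $\triangleright: H\otimes A\to A$ with $h\triangleright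 1_A=\varepsilon_H(h)1_A$, $1_H\triangleright a=a$, and $h\triangleright(ab)=(h_{(1)}\triangleright a)(h_{(2)}\triangleright b)$. Given a weak action $\triangleright$ and a $k$-linear map $f:H\otimes H\to A$ (write $f(g,h)=f(g\otimes h)$), $A\#_f^{\triangleright}H$ denotes the vector space $A\otimes H$ (write $a\#h$ for $a\otimes h$) with multiplication $(a\#h)\cdot(c\#g):=a(h_{(1)}\triangleright c)f(h_{(2)},g_{(1)})\#h_{(3)}g_{(2)}$. $(A,H,\triangleright,f)$ is a crossed system of Hopf algebras, and $A\#_f^{\triangleright}H$ (also written $A\#H$) a crossed product of Hopf algebras, if $A\#_f^{\triangleright}H$ is a Hopf algebra with this multiplication, unit $1_A\#1_H$ and the tensor product coalgebra structure. $\mathrm{Crp}(H,A)$ is the set of Hopf algebra isomorphism types of all crossed products $A\#_f^{\triangleright}H$. Let $\mathcal{CS}(A,H)$ be the set of pairs $(\triangleright,f)$ such that $(A,H,\triangleright,f)$ is a crossed system of Hopf algebras. Put $(\triangleright,f)\approx(\triangleright',f')$ if there is a unitary cocentral map $r:H\to A$ (a coalgebra map with $r(1)=1$ and $r(h_{(1)})\otimes h_{(2)}=r(h_{(2)})\otimes h_{(1)}$ for all $h$) such that $h\triangleright' a=r(h_{(1)})(h_{(2)}\triangleright a)(S_A\circ r)(h_{(3)})$ and $f'(h,g)=r(h_{(1)})\bigl(h_{(2)}\triangleright r(g_{(1)})\bigr)f(h_{(3)},g_{(2)})(S_A\circ r)(h_{(4)}g_{(3)})$ for all $a\in A$, $h,g\in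 H$. This is an equivalence relation, and $\mathcal{H}^2(H,A):=\mathcal{CS}(A,H)/\approx$. *)

theory Defs
  imports "HOL-Analysis.Analysis" "HOL-Library.Poly_Mapping"
begin

section \<open>Tensor products\<close>

text \<open>
  Vector spaces over a field \<open>'k\<close> are types \<open>'a\<close> of class \<^class>\<open>ab_group_add\<close> together with an
  explicit scalar multiplication.  Tensors are represented by formal linear combinations of pairs,
  i.e. elements of the free vector space \<open>('a \<times> 'b) \<Rightarrow>\<^sub>0 'k\<close>; two of them represent the same element
  of the tensor product iff they differ by an element of the subspace \<open>tensor_null\<close> spanned by the
  usual bilinearity relations.
\<close>

definition fscale :: "'k::field \<Rightarrow> ('p \<Rightarrow>\<^sub>0 'k) \<Rightarrow> ('p \<Rightarrow>\<^sub>0 'k)"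
  where "fscale c s = Poly_Mapping.map ((*) c) s"

lemma lookup_fscale [simp]: "Poly_Mapping.lookup (fscale c s) p = c * Poly_Mapping.lookup s p"
  by (simp add: fscale_def Poly_Mapping.map.rep_eq when_def)

interpretation formal: vector_space fscale
  by unfold_locales (auto intro!: poly_mapping_eqI simp: lookup_add algebra_simps)

text \<open>The linear extension of \<open>\<phi>\<close> from basis elements to formal linear combinations;
  \<open>t\<close> is the scalar multiplication of the target space.\<close>

definition fsum :: "('k::field \<Rightarrow> 'c \<Rightarrow> 'c) \<Rightarrow> ('p \<Rightarrow> 'c::ab_group_add) \<Rightarrow> ('p \<Rightarrow>\<^sub>0 'k) \<Rightarrow> 'c"
  where "fsum t \<phi> s = (\<Sum>p\<in>Poly_Mapping.keys s. t (Poly_Mapping.lookup s p) (\<phi> p))"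

abbreviation tens :: "'a \<Rightarrow> 'b \<Rightarrow> ('a \<times> 'b) \<Rightarrow>\<^sub>0 'k::field"  (infix \<open>\<otimes>\<close> 72)
  where "a \<otimes> b \<equiv> Poly_Mapping.single (a, b) 1"

definition tensor_null ::
    "('k::field \<Rightarrow> 'a \<Rightarrow> 'a::ab_group_add) \<Rightarrow> ('k \<Rightarrow> 'b \<Rightarrow> 'b::ab_group_add) \<Rightarrow> ('a \<times> 'b \<Rightarrow>\<^sub>0 'k) set"
  where "tensor_null sA sB = formal.span
    ({(a + a') \<otimes> b - a \<otimes> b - a' \<otimes> b | a a' b. True} \<union>
     {a \<otimes> (b + b') - a \<otimes> b - a \<otimes> b' | a b b'. True} \<union>
     {sA c a \<otimes> b - fscale c (a \<otimes> b) | c a b. True} \<union>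
     {a \<otimes> sB c b - fscale c (a \<otimes> b) | c a b. True})"

definition tensor_eq ::
    "('k::field \<Rightarrow> 'a \<Rightarrow> 'a::ab_group_add) \<Rightarrow> ('k \<Rightarrow> 'b \<Rightarrow> 'b::ab_group_add) \<Rightarrow>
     ('a \<times> 'b \<Rightarrow>\<^sub>0 'k) \<Rightarrow> ('a \<times> 'b \<Rightarrow>\<^sub>0 'k) \<Rightarrow> bool"
  where "tensor_eq sA sB s t \<longleftrightarrow> s - t \<in> tensor_null sA sB"

text \<open>Equality in \<open>A \<otimes> A \<otimes> A\<close>: the relations are those of \<open>A \<otimes> A\<close>, applied to the first two or to
  the last two factors.\<close>

definition tensor3_eq ::
    "('k::field \<Rightarrow> 'a \<Rightarrow> 'a::ab_group_add) \<Rightarrow> ('a \<times> 'a \<times> 'a \<Rightarrow>\<^sub>0 'k) \<Rightarrow> ('a \<times> 'a \<times> 'a \<Rightarrow>\<^sub>0 'k) \<Rightarrow> bool"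
  where "tensor3_eq sA s t \<longleftrightarrow> s - t \<in> formal.span
    ({fsum fscale (\<lambda>(a, b). Poly_Mapping.single (a, b, c) 1) n | n c. n \<in> tensor_null sA sA} \<union>
     {fsum fscale (\<lambda>(b, c). Poly_Mapping.single (a, b, c) 1) n | n a. n \<in> tensor_null sA sA})"

definition bilinear_map ::
    "('k::field \<Rightarrow> 'a \<Rightarrow> 'a::ab_group_add) \<Rightarrow> ('k \<Rightarrow> 'b \<Rightarrow> 'b::ab_group_add) \<Rightarrow>
     ('k \<Rightarrow> 'c \<Rightarrow> 'c::ab_group_add) \<Rightarrow> ('a \<Rightarrow> 'b \<Rightarrow> 'c) \<Rightarrow> bool"
  where "bilinear_map sA sB sC \<phi> \<longleftrightarrow>
    (\<forall>a. Vector_Spaces.linear sB sC (\<phi> a)) \<and> (\<forall>b. Vector_Spaces.linear sA sC (\<lambda>a. \<phi> a b))"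


section \<open>Hopf algebras\<close>

text \<open>\<open>hcomult A a\<close> is a formal sum representing \<open>\<Delta>(a) \<in> A \<otimes> A\<close>; all axioms only refer to the element
  of \<open>A \<otimes> A\<close> it represents.\<close>

record (overloaded) ('k::field, 'a) hopf =
  hscale :: "'k \<Rightarrow> 'a \<Rightarrow> 'a"
  hmult :: "'a \<Rightarrow> 'a \<Rightarrow> 'a"
  hone :: 'a
  hcomult :: "'a \<Rightarrow> ('a \<times> 'a) \<Rightarrow>\<^sub>0 'k"
  hcounit :: "'a \<Rightarrow> 'k"

text \<open>Sweedler sums: for a multilinear \<open>\<phi>\<close> these are \<open>\<Sum> \<phi>(a\<^sub>(\<^sub>1\<^sub>), a\<^sub>(\<^sub>2\<^sub>))\<close>, and so on.\<close>

definition sw2 :: "('k::field \<Rightarrow> 'c \<Rightarrow> 'c::ab_group_add) \<Rightarrow> ('k, 'a) hopf \<Rightarrow> ('a \<Rightarrow> 'a \<Rightarrow> 'c) \<Rightarrow> 'a \<Rightarrow> 'c"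
  where "sw2 t A \<phi> a = fsum t (\<lambda>(a1, a2). \<phi> a1 a2) (hcomult A a)"

definition sw3 :: "('k::field \<Rightarrow> 'c \<Rightarrow> 'c::ab_group_add) \<Rightarrow> ('k, 'a) hopf \<Rightarrow>
    ('a \<Rightarrow> 'a \<Rightarrow> 'a \<Rightarrow> 'c) \<Rightarrow> 'a \<Rightarrow> 'c"
  where "sw3 t A \<phi> a = sw2 t A (\<lambda>a1 b. sw2 t A (\<phi> a1) b) a"

definition sw4 :: "('k::field \<Rightarrow> 'c \<Rightarrow> 'c::ab_group_add) \<Rightarrow> ('k, 'a) hopf \<Rightarrow>
    ('a \<Rightarrow> 'a \<Rightarrow> 'a \<Rightarrow> 'a \<Rightarrow> 'c) \<Rightarrow> 'a \<Rightarrow> 'c"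
  where "sw4 t A \<phi> a = sw2 t A (\<lambda>a1 b. sw3 t A (\<phi> a1) b) a"

definition is_antipode :: "('k::field, 'a::ab_group_add) hopf \<Rightarrow> ('a \<Rightarrow> 'a) \<Rightarrow> bool"
  where "is_antipode A S \<longleftrightarrow> Vector_Spaces.linear (hscale A) (hscale A) S \<and>
    (\<forall>a. sw2 (hscale A) A (\<lambda>a1 a2. hmult A (S a1) a2) a = hscale A (hcounit A a) (hone A)) \<and>
    (\<forall>a. sw2 (hscale A) A (\<lambda>a1 a2. hmult A a1 (S a2)) a = hscale A (hcounit A a) (hone A))"

definition antipode :: "('k::field, 'a::ab_group_add) hopf \<Rightarrow> 'a \<Rightarrow> 'a"
  where "antipode A = (THE S. is_antipode A S)"

locale hopf_algebra =
  fixes A :: "('k::field, 'a::ab_group_add) hopf"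
  assumes vector_space: "vector_space (hscale A)"
    and mult_bilinear: "bilinear_map (hscale A) (hscale A) (hscale A) (hmult A)"
    and mult_assoc: "hmult A (hmult A a b) c = hmult A a (hmult A b c)"
    and mult_one_left: "hmult A (hone A) a = a"
    and mult_one_right: "hmult A a (hone A) = a"
    and counit_linear: "Vector_Spaces.linear (hscale A) (*) (hcounit A)"
    and comult_add: "tensor_eq (hscale A) (hscale A) (hcomult A (a + b)) (hcomult A a + hcomult A b)"
    and comult_scale:
      "tensor_eq (hscale A) (hscale A) (hcomult A (hscale A r a)) (fscale r (hcomult A a))"
    and coassoc: "tensor3_eq (hscale A)
      (sw2 fscale A (\<lambda>b a3. sw2 fscale A (\<lambda>a1 a2. Poly_Mapping.single (a1, a2, a3) 1) b) a)
      (sw2 fscale A (\<lambda>a1 b. sw2 fscale A (\<lambda>a2 a3. Poly_Mapping.single (a1, a2, a3) 1) b) a)"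
    and counit_left: "sw2 (hscale A) A (\<lambda>a1 a2. hscale A (hcounit A a1) a2) a = a"
    and counit_right: "sw2 (hscale A) A (\<lambda>a1 a2. hscale A (hcounit A a2) a1) a = a"
    and comult_one: "tensor_eq (hscale A) (hscale A) (hcomult A (hone A)) (hone A \<otimes> hone A)"
    and comult_mult: "tensor_eq (hscale A) (hscale A) (hcomult A (hmult A a b))
      (sw2 fscale A (\<lambda>a1 a2. sw2 fscale A (\<lambda>b1 b2. hmult A a1 b1 \<otimes> hmult A a2 b2) b) a)"
    and counit_one: "hcounit A (hone A) = 1"
    and counit_mult: "hcounit A (hmult A a b) = hcounit A a * hcounit A b"
    and antipode_exists: "\<exists>S. is_antipode A S"

definition coalgebra_map ::
    "('k::field, 'a::ab_group_add) hopf \<Rightarrow> ('k, 'b::ab_group_add) hopf \<Rightarrow> ('a \<Rightarrow> 'b) \<Rightarrow> bool"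
  where "coalgebra_map A B \<phi> \<longleftrightarrow> Vector_Spaces.linear (hscale A) (hscale B) \<phi> \<and>
    (\<forall>a. tensor_eq (hscale B) (hscale B)
       (hcomult B (\<phi> a)) (sw2 fscale A (\<lambda>a1 a2. \<phi> a1 \<otimes> \<phi> a2) a)) \<and>
    (\<forall>a. hcounit B (\<phi> a) = hcounit A a)"

definition hopf_hom ::
    "('k::field, 'a::ab_group_add) hopf \<Rightarrow> ('k, 'b::ab_group_add) hopf \<Rightarrow> ('a \<Rightarrow> 'b) \<Rightarrow> bool"
  where "hopf_hom A B \<phi> \<longleftrightarrow> coalgebra_map A B \<phi> \<and> \<phi> (hone A) = hone B \<and>
    (\<forall>a b. \<phi> (hmult A a b) = hmult B (\<phi> a) (\<phi> b))"

definition hopf_iso ::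
    "('k::field, 'a::ab_group_add) hopf \<Rightarrow> ('k, 'b::ab_group_add) hopf \<Rightarrow> ('a \<Rightarrow> 'b) \<Rightarrow> bool"
  where "hopf_iso A B \<phi> \<longleftrightarrow> hopf_hom A B \<phi> \<and> bij \<phi>"

definition Aut_Hopf :: "('k::field, 'a::ab_group_add) hopf \<Rightarrow> ('a \<Rightarrow> 'a) set"
  where "Aut_Hopf A = {u. hopf_iso A A u}"

definition trivial_hom ::
    "('k::field, 'a::ab_group_add) hopf \<Rightarrow> ('k, 'b::ab_group_add) hopf \<Rightarrow> 'a \<Rightarrow> 'b"
  where "trivial_hom A B a = hscale B (hcounit A a) (hone B)"

definition primitives :: "('k::field, 'a::ab_group_add) hopf \<Rightarrow> 'a set"
  where "primitives A =
    {z. tensor_eq (hscale A) (hscale A) (hcomult A z) (z \<otimes> hone A + hone A \<otimes> z)}"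

definition center :: "('k::field, 'a::ab_group_add) hopf \<Rightarrow> 'a set"
  where "center A = {z. \<forall>a. hmult A z a = hmult A a z}"

definition ZP :: "('k::field, 'a::ab_group_add) hopf \<Rightarrow> 'a set"
  where "ZP A = primitives A \<inter> center A"

definition ZP_rel :: "('k::field, 'a::ab_group_add) hopf \<Rightarrow> ('a \<times> 'a) set"
  where "ZP_rel A = {(a, b). a \<in> ZP A \<and> b \<in> ZP A \<and>
    (\<exists>u \<in> Aut_Hopf A. \<exists>\<beta>. \<beta> \<noteq> 0 \<and> u a = hscale A (\<beta>\<^sup>2) b)}"


section \<open>Crossed products\<close>

text \<open>
  In a crossed product \<open>A # H\<close> the Hopf algebra \<open>H\<close> is finite-dimensional and given in coordinates
  with respect to a basis indexed by a finite type \<open>'i\<close>: its underlying vector space is \<open>'k ^ 'i\<close> with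
  the standard scalar multiplication \<open>(*s)\<close>.  The tensor product \<open>A \<otimes> H\<close> is then the type \<open>'a ^ 'i\<close>,
  with \<open>a # h = (\<chi> i. h\<^sub>i a)\<close>; every \<open>v\<close> is the sum of the \<open>v\<^sub>i # e\<^sub>i\<close>, where \<open>e\<^sub>i = axis i 1\<close>.  Lemmas
  \<open>tensor_eq_iff_vec\<close> and \<open>surj_fsum_cten\<close> below show that this is the tensor product.
\<close>

definition vscale :: "('k::field, 'a::ab_group_add) hopf \<Rightarrow> 'k \<Rightarrow> 'a ^ 'i \<Rightarrow> 'a ^ 'i::finite"
  where "vscale A c v = (\<chi> i. hscale A c (v $ i))"

definition cten :: "('k::field, 'a::ab_group_add) hopf \<Rightarrow> 'a \<Rightarrow> 'k ^ 'i \<Rightarrow> 'a ^ 'i::finite"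
  where "cten A a h = (\<chi> i. hscale A (h $ i) a)"

lemma linear_fsum:
  fixes t :: "'k::field \<Rightarrow> 'b \<Rightarrow> 'b::ab_group_add" and \<phi> :: "'p \<Rightarrow> 'b"
  assumes "vector_space t"
  shows "Vector_Spaces.linear fscale t (fsum t \<phi>)"
proof -
  interpret t: vector_space t by fact
  have sup: "fsum t \<phi> s = (\<Sum>p\<in>K. t (Poly_Mapping.lookup s p) (\<phi> p))"
    if "finite K" "Poly_Mapping.keys s \<subseteq> K" for s K
    unfolding fsum_def by (rule sum.mono_neutral_left) (use that in \<open>auto simp: in_keys_iff\<close>)
  show ?thesis
    unfolding Vector_Spaces.linear_iff
  proof (intro conjI allI)
    fix x y :: "'p \<Rightarrow>\<^sub>0 'k" and c :: 'k
    let ?K = "Poly_Mapping.keys x \<union> Poly_Mapping.keys y"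
    have "fsum t \<phi> (x + y) = (\<Sum>p\<in>?K. t (Poly_Mapping.lookup (x + y) p) (\<phi> p))"
      by (rule sup) (use Poly_Mapping.keys_add[of x y] in auto)
    then show "fsum t \<phi> (x + y) = fsum t \<phi> x + fsum t \<phi> y"
      by (simp add: lookup_add t.scale_left_distrib sum.distrib sup[of ?K])
    have "Poly_Mapping.keys (fscale c x) \<subseteq> Poly_Mapping.keys x"
      by (auto simp: in_keys_iff)
    then show "fsum t \<phi> (fscale c x) = t c (fsum t \<phi> x)"
      by (simp add: sup[of "Poly_Mapping.keys x"] t.scale_sum_right)
  qed (use assms formal.vector_space_axioms in auto)
qed

lemma fsum_single:
  assumes "vector_space t"
  shows "fsum t \<phi> (Poly_Mapping.single p c) = t c (\<phi> p)"
proof -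
  interpret vector_space t by fact
  show ?thesis by (cases "c = 0") (auto simp: fsum_def)
qed

lemma fsum_linear:
  assumes "vector_space t"
  shows "fsum t \<phi> (x + y) = fsum t \<phi> x + fsum t \<phi> y"
    and "fsum t \<phi> (x - y) = fsum t \<phi> x - fsum t \<phi> y"
    and "fsum t \<phi> (fscale c x) = t c (fsum t \<phi> x)"
    and "fsum t \<phi> (\<Sum>i\<in>I. h i) = (\<Sum>i\<in>I. fsum t \<phi> (h i))"
    and "fsum t \<phi> 0 = 0"
proof -
  interpret Vector_Spaces.linear fscale t "fsum t \<phi>"
    by (rule linear_fsum[OF assms])
  show "fsum t \<phi> (x + y) = fsum t \<phi> x + fsum t \<phi> y"
    "fsum t \<phi> (x - y) = fsum t \<phi> x - fsum t \<phi> y"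
    "fsum t \<phi> (fscale c x) = t c (fsum t \<phi> x)"
    "fsum t \<phi> (\<Sum>i\<in>I. h i) = (\<Sum>i\<in>I. fsum t \<phi> (h i))"
    "fsum t \<phi> 0 = 0"
    by (rule add diff scale sum zero)+
qed

lemma formal_expand: "s = (\<Sum>p\<in>Poly_Mapping.keys s. fscale (Poly_Mapping.lookup s p) (Poly_Mapping.single p 1))"
  by (rule poly_mapping_eqI) 
    (auto simp: lookup_sum lookup_single when_def in_keys_iff if_distrib sum.delta cong: if_cong)

lemma tensor_eq_fsum:
  assumes bil: "bilinear_map sA sB sC \<phi>" and C: "vector_space sC" and eq: "tensor_eq sA sB s s'"
  shows "fsum sC (case_prod \<phi>) s = fsum sC (case_prod \<phi>) s'"
proof -
  interpret C: vector_space sC by fact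
  interpret L: Vector_Spaces.linear fscale sC "fsum sC (case_prod \<phi>)"
    by (rule linear_fsum[OF C])
  have l: "\<phi> a (b + b') = \<phi> a b + \<phi> a b'" "\<phi> a (sB c b) = sC c (\<phi> a b)"
    "\<phi> (a + a') b = \<phi> a b + \<phi> a' b" "\<phi> (sA c a) b = sC c (\<phi> a b)" for a a' b b' c
    using bil unfolding bilinear_map_def Vector_Spaces.linear_iff by auto
  have "s - s' \<in> tensor_null sA sB"
    using eq by (simp add: tensor_eq_def)
  then have "fsum sC (case_prod \<phi>) (s - s') = 0"
    unfolding tensor_null_def
  proof (induction rule: formal.span_induct)
    case base
    show ?case
      by (auto simp: formal.subspace_def fsum_linear[OF C])
  next
    case (step x)
    then show ?case
      by (auto simp: fsum_linear[OF C] fsum_single[OF C] l)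
  qed
  then show ?thesis
    by (simp add: fsum_linear[OF C])
qed

lemma tensor_eq_refl [simp]: "tensor_eq sA sB s s"
  and tensor_eq_sym: "tensor_eq sA sB s t \<Longrightarrow> tensor_eq sA sB t s"
  and tensor_eq_trans [trans]: "tensor_eq sA sB s t \<Longrightarrow> tensor_eq sA sB t u \<Longrightarrow> tensor_eq sA sB s u"
  and tensor_eq_add: "tensor_eq sA sB s t \<Longrightarrow> tensor_eq sA sB s' t' \<Longrightarrow> tensor_eq sA sB (s + s') (t + t')"
  and tensor_eq_scale: "tensor_eq sA sB s t \<Longrightarrow> tensor_eq sA sB (fscale c s) (fscale c t)"
proof -
  show "tensor_eq sA sB s s"
    by (simp add: tensor_eq_def tensor_null_def formal.span_zero)
  show "tensor_eq sA sB t s" if "tensor_eq sA sB s t"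
    using that formal.span_neg[of "s - t"] by (simp add: tensor_eq_def tensor_null_def)
  show "tensor_eq sA sB s u" if "tensor_eq sA sB s t" "tensor_eq sA sB t u"
    using that formal.span_add[of "s - t" _ "t - u"] by (simp add: tensor_eq_def tensor_null_def)
  show "tensor_eq sA sB (s + s') (t + t')" if "tensor_eq sA sB s t" "tensor_eq sA sB s' t'"
    using that formal.span_add[of "s - t" _ "s' - t'"]
    by (simp add: tensor_eq_def tensor_null_def algebra_simps)
  show "tensor_eq sA sB (fscale c s) (fscale c t)" if "tensor_eq sA sB s t"
    using that formal.span_scale[of "s - t" _ c]
    by (simp add: tensor_eq_def tensor_null_def formal.scale_right_diff_distrib)
qed

lemma tensor_eq_sum:
  "(\<And>i. i \<in> I \<Longrightarrow> tensor_eq sA sB (s i) (t i)) \<Longrightarrow> tensor_eq sA sB (\<Sum>i\<in>I. s i) (\<Sum>i\<in>I. t i)"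
  by (induction I rule: infinite_finite_induct) (auto intro: tensor_eq_add)

lemma tensor_eq_rel:
  shows "tensor_eq sA sB ((a + a') \<otimes> b) (a \<otimes> b + a' \<otimes> b)"
    and "tensor_eq sA sB (a \<otimes> (b + b')) (a \<otimes> b + a \<otimes> b')"
    and "tensor_eq sA sB (sA c a \<otimes> b) (fscale c (a \<otimes> b))"
    and "tensor_eq sA sB (a \<otimes> sB c b) (fscale c (a \<otimes> b))"
  unfolding tensor_eq_def tensor_null_def
  by (rule formal.span_base; force simp: algebra_simps)+

lemma tensor_eq_zero_right: "tensor_eq sA sB (a \<otimes> 0) 0"
proof -
  have "tensor_eq sA sB (a \<otimes> (0 + 0)) (a \<otimes> 0 + a \<otimes> 0)" by (rule tensor_eq_rel)
  then show ?thesis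
    using formal.span_neg by (force simp: tensor_eq_def tensor_null_def)
qed

lemma tensor_eq_sum_right: "tensor_eq sA sB (a \<otimes> (\<Sum>i\<in>I. b i)) (\<Sum>i\<in>I. a \<otimes> b i)"
proof (induction I rule: infinite_finite_induct)
  case (insert x F)
  have "tensor_eq sA sB (a \<otimes> (b x + sum b F)) (a \<otimes> b x + a \<otimes> sum b F)"
    by (rule tensor_eq_rel)
  also have "tensor_eq sA sB \<dots> (a \<otimes> b x + (\<Sum>i\<in>F. a \<otimes> b i))"
    by (rule tensor_eq_add) (auto intro: insert)
  finally show ?case using insert by simp
qed (auto intro: tensor_eq_zero_right)

lemma vector_space_vscale:
  assumes "vector_space (hscale A)"
  shows "vector_space (vscale A)"
proof -
  interpret vector_space "hscale A" by fact
  show ?thesis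
    by unfold_locales (auto simp: vscale_def vec_eq_iff scale_left_distrib scale_right_distrib)
qed

lemma bilinear_cten:
  assumes "vector_space (hscale A)"
  shows "bilinear_map (hscale A) (*s) (vscale A) (cten A)"
proof -
  interpret vector_space "hscale A" by fact
  show ?thesis
    using vector_space_vscale[OF assms] assms vec.vector_space_axioms
    unfolding bilinear_map_def Vector_Spaces.linear_iff
    by (auto simp: cten_def vscale_def vec_eq_iff scale_left_distrib scale_right_distrib mult.commute)
qed

theorem tensor_eq_iff_vec:
  fixes A :: "('k::field, 'a::ab_group_add) hopf" and s s' :: "'a \<times> ('k ^ 'i::finite) \<Rightarrow>\<^sub>0 'k"
  assumes A: "vector_space (hscale A)"
  shows "tensor_eq (hscale A) (*s) s s' \<longleftrightarrow>
    fsum (vscale A) (case_prod (cten A)) s = fsum (vscale A) (case_prod (cten A)) s'"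
proof
  assume "tensor_eq (hscale A) (*s) s s'"
  then show "fsum (vscale A) (case_prod (cten A)) s = fsum (vscale A) (case_prod (cten A)) s'"
    by (intro tensor_eq_fsum[OF bilinear_cten vector_space_vscale] A)
next
  interpret vector_space "hscale A" by fact
  let ?eq = "tensor_eq (hscale A) ((*s) :: 'k \<Rightarrow> 'k ^ 'i \<Rightarrow> 'k ^ 'i)"
  let ?E = "fsum (vscale A) (case_prod (cten A)) :: _ \<Rightarrow> 'a ^ 'i"
  define N :: "'a ^ 'i \<Rightarrow> 'a \<times> ('k ^ 'i) \<Rightarrow>\<^sub>0 'k" where "N v = (\<Sum>i\<in>UNIV. v $ i \<otimes> axis i 1)" for v
  have N_add: "?eq (N (v + w)) (N v + N w)" for v w
    unfolding N_def sum.distrib[symmetric] by (intro tensor_eq_sum) (simp add: tensor_eq_rel)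
  have N_scale: "?eq (N (vscale A c v)) (fscale c (N v))" for c v
    unfolding N_def formal.scale_sum_right
    by (intro tensor_eq_sum) (simp add: tensor_eq_rel vscale_def)
  have N_pure: "?eq (N (cten A a h)) (a \<otimes> h)" for a h
  proof -
    have "?eq (N (cten A a h)) (\<Sum>i\<in>UNIV. fscale (h $ i) (a \<otimes> axis i 1))"
      unfolding N_def by (intro tensor_eq_sum) (simp add: tensor_eq_rel cten_def)
    also have "?eq \<dots> (\<Sum>i\<in>UNIV. a \<otimes> (h $ i *s axis i 1))"
      by (intro tensor_eq_sum tensor_eq_sym[OF tensor_eq_rel(4)])
    also have "?eq \<dots> (a \<otimes> (\<Sum>i\<in>UNIV. h $ i *s axis i 1))"
      by (rule tensor_eq_sym[OF tensor_eq_sum_right])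
    finally show ?thesis
      by (simp add: basis_expansion)
  qed
  have N_sum: "?eq (N (\<Sum>i\<in>I. v i)) (\<Sum>i\<in>I. N (v i))" for v and I :: "('a \<times> ('k ^ 'i)) set"
  proof (induction I rule: infinite_finite_induct)
    case (insert x F)
    have "?eq (N (v x + sum v F)) (N (v x) + N (sum v F))" by (rule N_add)
    also have "?eq \<dots> (N (v x) + (\<Sum>i\<in>F. N (v i)))"
      by (rule tensor_eq_add) (auto intro: insert)
    finally show ?case using insert by simp
  qed (use N_scale[of 0 0] in \<open>auto simp: vscale_def zero_vec_def\<close>)
  have N_E: "?eq s (N (?E s))" for s
  proof -
    have "?eq (N (?E s)) (\<Sum>p\<in>Poly_Mapping.keys s.
        N (vscale A (Poly_Mapping.lookup s p) (case_prod (cten A) p)))"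
      unfolding fsum_def by (rule N_sum)
    also have "?eq \<dots> (\<Sum>p\<in>Poly_Mapping.keys s.
        fscale (Poly_Mapping.lookup s p) (N (case_prod (cten A) p)))"
      by (intro tensor_eq_sum N_scale)
    also have "?eq \<dots> (\<Sum>p\<in>Poly_Mapping.keys s.
        fscale (Poly_Mapping.lookup s p) (Poly_Mapping.single p 1))"
      by (intro tensor_eq_sum tensor_eq_scale) (auto intro: N_pure split: prod.split)
    finally have "?eq (N (?E s)) s"
      by (simp only: formal_expand[symmetric])
    then show ?thesis
      by (rule tensor_eq_sym)
  qed
  assume "?E s = ?E s'"
  then show "?eq s s'"
    using tensor_eq_trans[OF N_E[of s] tensor_eq_sym[OF N_E[of s', folded \<open>?E s = ?E s'\<close>]]] by simp
qed

theorem surj_fsum_cten: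
  fixes A :: "('k::field, 'a::ab_group_add) hopf"
  assumes A: "vector_space (hscale A)"
  shows "surj (fsum (vscale A) (case_prod (cten A)) :: _ \<Rightarrow> 'a ^ 'i::finite)"
proof (rule surjI)
  interpret vector_space "hscale A" by fact
  fix v :: "'a ^ 'i"
  have "fsum (vscale A) (case_prod (cten A)) (\<Sum>i\<in>UNIV. v $ i \<otimes> axis i 1) =
      (\<Sum>i\<in>UNIV. vscale A 1 (cten A (v $ i) (axis i 1)))"
    by (simp add: fsum_linear[OF vector_space_vscale[OF A]] fsum_single[OF vector_space_vscale[OF A]])
  also have "\<dots> = v"
    by (simp add: vec_eq_iff vscale_def cten_def axis_def if_distrib[of "\<lambda>c. hscale A c _"] sum.delta
        cong: if_cong)
  finally show "fsum (vscale A) (case_prod (cten A)) (\<Sum>i\<in>UNIV. v $ i \<otimes> axis i 1) = v" .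
qed

definition weak_action ::
    "('k::field, 'h::ab_group_add) hopf \<Rightarrow> ('k, 'a::ab_group_add) hopf \<Rightarrow> ('h \<Rightarrow> 'a \<Rightarrow> 'a) \<Rightarrow> bool"
  where "weak_action H A act \<longleftrightarrow>
    bilinear_map (hscale H) (hscale A) (hscale A) act \<and>
    (\<forall>h. act h (hone A) = hscale A (hcounit H h) (hone A)) \<and>
    (\<forall>a. act (hone H) a = a) \<and>
    (\<forall>h a b. act h (hmult A a b) =
       sw2 (hscale A) H (\<lambda>h1 h2. hmult A (act h1 a) (act h2 b)) h)"

text \<open>\<open>(a # h) (c # g) = \<Sum> a (h\<^sub>1 \<triangleright> c) f(h\<^sub>2, g\<^sub>1) # h\<^sub>3 g\<^sub>2\<close>\<close>

definition cp_mult_pure :: "('k::field, 'a::ab_group_add) hopf \<Rightarrow> ('k, 'k ^ 'i) hopf \<Rightarrow>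
    ('k ^ 'i \<Rightarrow> 'a \<Rightarrow> 'a) \<Rightarrow> ('k ^ 'i \<Rightarrow> 'k ^ 'i \<Rightarrow> 'a) \<Rightarrow>
    'a \<Rightarrow> 'k ^ 'i \<Rightarrow> 'a \<Rightarrow> 'k ^ 'i \<Rightarrow> 'a ^ 'i::finite"
  where "cp_mult_pure A H act f a h c g =
    sw3 (vscale A) H (\<lambda>h1 h2 h3.
      sw2 (vscale A) H (\<lambda>g1 g2.
        cten A (hmult A (hmult A a (act h1 c)) (f h2 g1)) (hmult H h3 g2)) g) h"

definition crossed_product :: "('k::field, 'a::ab_group_add) hopf \<Rightarrow> ('k, 'k ^ 'i) hopf \<Rightarrow>
    ('k ^ 'i \<Rightarrow> 'a \<Rightarrow> 'a) \<Rightarrow> ('k ^ 'i \<Rightarrow> 'k ^ 'i \<Rightarrow> 'a) \<Rightarrow> ('k, 'a ^ 'i::finite) hopf"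
  where "crossed_product A H act f = \<lparr>
    hscale = vscale A,
    hmult = (\<lambda>v w. \<Sum>i\<in>UNIV. \<Sum>j\<in>UNIV.
      cp_mult_pure A H act f (v $ i) (axis i 1) (w $ j) (axis j 1)),
    hone = cten A (hone A) (hone H),
    hcomult = (\<lambda>v. \<Sum>i\<in>UNIV.
      sw2 fscale A (\<lambda>a1 a2.
        sw2 fscale H (\<lambda>h1 h2. cten A a1 h1 \<otimes> cten A a2 h2) (axis i 1)) (v $ i)),
    hcounit = (\<lambda>v. \<Sum>i\<in>UNIV. hcounit A (v $ i) * hcounit H (axis i 1)) \<rparr>"

text \<open>Linear maps \<open>H \<otimes> A \<rightarrow> A\<close> and \<open>H \<otimes> H \<rightarrow> A\<close> are given as bilinear maps.\<close>

definition crossed_system :: "('k::field, 'a::ab_group_add) hopf \<Rightarrow> ('k, 'k ^ 'i::finite) hopf \<Rightarrow>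
    ('k ^ 'i \<Rightarrow> 'a \<Rightarrow> 'a) \<Rightarrow> ('k ^ 'i \<Rightarrow> 'k ^ 'i \<Rightarrow> 'a) \<Rightarrow> bool"
  where "crossed_system A H act f \<longleftrightarrow>
    weak_action H A act \<and>
    bilinear_map (hscale H) (hscale H) (hscale A) f \<and>
    hopf_algebra (crossed_product A H act f)"

definition CS :: "('k::field, 'a::ab_group_add) hopf \<Rightarrow> ('k, 'k ^ 'i::finite) hopf \<Rightarrow>
    (('k ^ 'i \<Rightarrow> 'a \<Rightarrow> 'a) \<times> ('k ^ 'i \<Rightarrow> 'k ^ 'i \<Rightarrow> 'a)) set"
  where "CS A H = {(act, f). crossed_system A H act f}"

text \<open>Isomorphism types are the classes, under Hopf algebra isomorphism, of the set of all crossed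
  products of \<open>A\<close> and \<open>H\<close>.\<close>

definition Crp :: "('k::field, 'k ^ 'i::finite) hopf \<Rightarrow> ('k, 'a::ab_group_add) hopf \<Rightarrow>
    ('k, 'a ^ 'i) hopf set set"
  where "Crp H A = (let P = {crossed_product A H act f | act f. crossed_system A H act f}
    in P // {(X, Y). X \<in> P \<and> Y \<in> P \<and> (\<exists>\<phi>. hopf_iso X Y \<phi>)})"

definition unitary_cocentral ::
    "('k::field, 'h::ab_group_add) hopf \<Rightarrow> ('k, 'a::ab_group_add) hopf \<Rightarrow> ('h \<Rightarrow> 'a) \<Rightarrow> bool"
  where "unitary_cocentral H A r \<longleftrightarrow> coalgebra_map H A r \<and> r (hone H) = hone A \<and>
    (\<forall>h. tensor_eq (hscale A) (hscale H)
       (sw2 fscale H (\<lambda>h1 h2. r h1 \<otimes> h2) h) (sw2 fscale H (\<lambda>h1 h2. r h2 \<otimes> h1) h))"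

definition CS_rel :: "('k::field, 'a::ab_group_add) hopf \<Rightarrow> ('k, 'k ^ 'i::finite) hopf \<Rightarrow>
    ((('k ^ 'i \<Rightarrow> 'a \<Rightarrow> 'a) \<times> ('k ^ 'i \<Rightarrow> 'k ^ 'i \<Rightarrow> 'a)) \<times>
     (('k ^ 'i \<Rightarrow> 'a \<Rightarrow> 'a) \<times> ('k ^ 'i \<Rightarrow> 'k ^ 'i \<Rightarrow> 'a))) set"
  where "CS_rel A H = {((act, f), (act', f')).
    (act, f) \<in> CS A H \<and> (act', f') \<in> CS A H \<and>
    (\<exists>r. unitary_cocentral H A r \<and>
      (\<forall>h a. act' h a =
         sw3 (hscale A) H (\<lambda>h1 h2 h3. hmult A (hmult A (r h1) (act h2 a)) (antipode A (r h3))) h) \<and>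
      (\<forall>h g. f' h g =
         sw4 (hscale A) H (\<lambda>h1 h2 h3 h4.
           sw3 (hscale A) H (\<lambda>g1 g2 g3.
             hmult A (hmult A (hmult A (r h1) (act h2 (r g1))) (f h3 g2))
               (antipode A (r (hmult H h4 g3)))) g) h))}"

definition H2 :: "('k::field, 'k ^ 'i::finite) hopf \<Rightarrow> ('k, 'a::ab_group_add) hopf \<Rightarrow>
    (('k ^ 'i \<Rightarrow> 'a \<Rightarrow> 'a) \<times> ('k ^ 'i \<Rightarrow> 'k ^ 'i \<Rightarrow> 'a)) set set"
  where "H2 H A = CS A H // CS_rel A H"


section \<open>Sweedler's Hopf algebra\<close>

datatype h4 = B1 | Bg | Bx | Bgx

instantiation h4 :: finite
begin
instance
proof
  have "(UNIV :: h4 set) = {B1, Bg, Bx, Bgx}"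
    using h4.exhaust by auto
  then show "finite (UNIV :: h4 set)"
    by (rule ssubst) simp
qed
end

lemma UNIV_h4: "(UNIV :: h4 set) = {B1, Bg, Bx, Bgx}"
  using h4.exhaust by auto

abbreviation h4e :: "h4 \<Rightarrow> 'k::field ^ h4"
  where "h4e i \<equiv> axis i 1"

text \<open>The multiplication table forced by \<open>g\<^sup>2 = 1\<close>, \<open>x\<^sup>2 = 0\<close> and \<open>x g = - g x\<close>.\<close>

fun h4_mult :: "h4 \<Rightarrow> h4 \<Rightarrow> 'k::field ^ h4" where
  "h4_mult B1 j = h4e j"
| "h4_mult i B1 = h4e i"
| "h4_mult Bg Bg = h4e B1"
| "h4_mult Bg Bx = h4e Bgx"
| "h4_mult Bg Bgx = h4e Bx"
| "h4_mult Bx Bg = - h4e Bgx"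
| "h4_mult Bgx Bg = - h4e Bx"
| "h4_mult Bx Bx = 0"
| "h4_mult Bx Bgx = 0"
| "h4_mult Bgx Bx = 0"
| "h4_mult Bgx Bgx = 0"

text \<open>The value at \<open>g x\<close> is the product of those at \<open>g\<close> and \<open>x\<close>.\<close>

fun h4_comult :: "h4 \<Rightarrow> ('k::field ^ h4) \<times> ('k ^ h4) \<Rightarrow>\<^sub>0 'k" where
  "h4_comult B1 = h4e B1 \<otimes> h4e B1"
| "h4_comult Bg = h4e Bg \<otimes> h4e Bg"
| "h4_comult Bx = h4e Bx \<otimes> h4e B1 + h4e Bg \<otimes> h4e Bx"
| "h4_comult Bgx = h4e Bgx \<otimes> h4e Bg + h4e B1 \<otimes> h4e Bgx"

fun h4_counit :: "h4 \<Rightarrow> 'k::field" where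
  "h4_counit B1 = 1"
| "h4_counit Bg = 1"
| "h4_counit Bx = 0"
| "h4_counit Bgx = 0"

definition H4 :: "('k::field, 'k ^ h4) hopf"
  where "H4 = \<lparr>
    hscale = (*s),
    hmult = (\<lambda>v w. \<Sum>i\<in>UNIV. \<Sum>j\<in>UNIV. (v $ i * w $ j) *s h4_mult i j),
    hone = h4e B1,
    hcomult = (\<lambda>v. \<Sum>i\<in>UNIV. fscale (v $ i) (h4_comult i)),
    hcounit = (\<lambda>v. \<Sum>i\<in>UNIV. v $ i * h4_counit i) \<rparr>"

lemma H4_sel [simp]:
  "hscale H4 = (*s)" "hone H4 = h4e B1"
  "hmult H4 v w = (\<Sum>i\<in>UNIV. \<Sum>j\<in>UNIV. (v $ i * w $ j) *s h4_mult i j)"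
  "hcomult H4 v = (\<Sum>i\<in>UNIV. fscale (v $ i) (h4_comult i))"
  "hcounit H4 v = (\<Sum>i\<in>UNIV. v $ i * h4_counit i)"
  by (simp_all add: H4_def)

lemma sw2_H4:
  assumes "vector_space t"
  shows "sw2 t H4 \<phi> v = t (v $ B1) (\<phi> (h4e B1) (h4e B1)) + t (v $ Bg) (\<phi> (h4e Bg) (h4e Bg))
    + t (v $ Bx) (\<phi> (h4e Bx) (h4e B1) + \<phi> (h4e Bg) (h4e Bx))
    + t (v $ Bgx) (\<phi> (h4e Bgx) (h4e Bg) + \<phi> (h4e B1) (h4e Bgx))"
proof -
  interpret vector_space t by fact
  show ?thesis
    by (simp add: sw2_def UNIV_h4 fsum_linear[OF assms] fsum_single[OF assms] algebra_simps)
qed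

lemma all_h4: "(\<forall>i. P i) \<longleftrightarrow> P B1 \<and> P Bg \<and> P Bx \<and> P Bgx"
  by (metis h4.exhaust)

lemma axis_h4 [simp]: "(axis i c :: 'k::zero ^ h4) $ j = (if i = j then c else 0)"
  by (auto simp: axis_def)

theorem hopf_algebra_H4: "hopf_algebra (H4 :: ('k::field, 'k ^ h4) hopf)"
proof (rule hopf_algebra.intro)
  note F = formal.vector_space_axioms
  have V: "vector_space ((*s) :: 'k \<Rightarrow> 'k ^ h4 \<Rightarrow> _)"
    by (rule vec.vector_space_axioms)
  have K: "vector_space ((*) :: 'k \<Rightarrow> _)"
    by (rule vector_space_over_itself.vector_space_axioms)
  note VV = vector_space_vscale[of "H4 :: ('k, 'k ^ h4) hopf", simplified, OF V]
  note teq = tensor_eq_iff_vec[of "H4 :: ('k, 'k ^ h4) hopf", simplified, OF V, where 'i = h4]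
  let ?H = "H4 :: ('k, 'k ^ h4) hopf"
  have cm: "hmult ?H v w = (\<chi> i. case i of
      B1 \<Rightarrow> v $ B1 * w $ B1 + v $ Bg * w $ Bg
    | Bg \<Rightarrow> v $ B1 * w $ Bg + v $ Bg * w $ B1
    | Bx \<Rightarrow> v $ B1 * w $ Bx + v $ Bx * w $ B1 + v $ Bg * w $ Bgx - v $ Bgx * w $ Bg
    | Bgx \<Rightarrow> v $ B1 * w $ Bgx + v $ Bgx * w $ B1 + v $ Bg * w $ Bx - v $ Bx * w $ Bg)" for v w
    by (simp add: vec_eq_iff all_h4 UNIV_h4)
  show "vector_space (hscale ?H)" by (simp add: V)
  show "bilinear_map (hscale ?H) (hscale ?H) (hscale ?H) (hmult ?H)"
    by (auto simp add: bilinear_map_def Vector_Spaces.linear_iff V cm vec_eq_iff all_h4 algebra_simps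
        simp del: H4_sel(3))
  show "Vector_Spaces.linear (hscale ?H) (*) (hcounit ?H)"
    by (auto simp add: Vector_Spaces.linear_iff V K UNIV_h4 algebra_simps)
  show "\<exists>S. is_antipode ?H S"
  proof
    show "is_antipode ?H (\<lambda>v. \<chi> i. case i of B1 \<Rightarrow> v $ B1 | Bg \<Rightarrow> v $ Bg | Bx \<Rightarrow> v $ Bgx | Bgx \<Rightarrow> - v $ Bx)"
      by (auto simp add: is_antipode_def sw2_H4[OF V] Vector_Spaces.linear_iff V cm vec_eq_iff all_h4
        UNIV_h4 simp del: H4_sel(3))
  qed
  fix a b c :: "'k ^ h4" and r :: 'k
  show "hmult ?H (hmult ?H a b) c = hmult ?H a (hmult ?H b c)"
    by (simp add: cm vec_eq_iff all_h4 algebra_simps del: H4_sel(3))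
  show "hmult ?H (hone ?H) a = a" "hmult ?H a (hone ?H) = a"
    by (simp_all add: cm vec_eq_iff all_h4 del: H4_sel(3))
  show "tensor_eq (hscale ?H) (hscale ?H) (hcomult ?H (a + b)) (hcomult ?H a + hcomult ?H b)"
    by (simp add: formal.scale_left_distrib sum.distrib)
  show "tensor_eq (hscale ?H) (hscale ?H) (hcomult ?H (hscale ?H r a)) (fscale r (hcomult ?H a))"
    by (simp add: formal.scale_sum_right)
  show "tensor3_eq (hscale ?H)
      (sw2 fscale ?H (\<lambda>b a3. sw2 fscale ?H (\<lambda>a1 a2. Poly_Mapping.single (a1, a2, a3) 1) b) a)
      (sw2 fscale ?H (\<lambda>a1 b. sw2 fscale ?H (\<lambda>a2 a3. Poly_Mapping.single (a1, a2, a3) 1) b) a)"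
    by (simp add: sw2_H4[OF F] tensor3_eq_def formal.span_zero algebra_simps)
  show "sw2 (hscale ?H) ?H (\<lambda>a1 a2. hscale ?H (hcounit ?H a1) a2) a = a"
    "sw2 (hscale ?H) ?H (\<lambda>a1 a2. hscale ?H (hcounit ?H a2) a1) a = a"
    by (simp_all add: sw2_H4[OF V] vec_eq_iff all_h4 UNIV_h4)
  show "tensor_eq (hscale ?H) (hscale ?H) (hcomult ?H (hone ?H)) (hone ?H \<otimes> hone ?H)"
    by (simp add: UNIV_h4)
  show "hcounit ?H (hone ?H) = 1" by (simp add: UNIV_h4)
  show "hcounit ?H (hmult ?H a b) = hcounit ?H a * hcounit ?H b"
    by (simp add: cm UNIV_h4 algebra_simps del: H4_sel(3))
  show "tensor_eq (hscale ?H) (hscale ?H) (hcomult ?H (hmult ?H a b))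
      (sw2 fscale ?H (\<lambda>a1 a2. sw2 fscale ?H (\<lambda>b1 b2. hmult ?H a1 b1 \<otimes> hmult ?H a2 b2) b) a)"
    by (simp add: teq sw2_H4[OF F] fsum_linear[OF VV] fsum_single[OF VV] cm cten_def vscale_def
        vec_eq_iff all_h4 UNIV_h4 algebra_simps del: H4_sel(3))
qed

declare H4_sel [simp del]

end

theory Submission imports Defs
begin

text \<open>
  A crossed system of \<open>A\<close> and \<open>H\<^sub>4\<close> is determined by one element of \<open>A\<close>.  Comparing components in
  \<open>\<Delta>(x c) = \<Delta>(x) \<Delta>(c)\<close> for \<open>c \<in> A\<close>, and likewise for \<open>g x\<close>, shows that the weak action is trivial:
  \<open>H\<^sub>4\<close> is so far from cocommutative that nothing else is compatible with the tensor product coalgebra.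
  The same comparison for the products of \<open>g\<close> and \<open>x\<close> gives \<open>g\<^sup>2 = 1\<close> and \<open>x g = - g x\<close> in the crossed
  product, while \<open>x\<^sup>2 = z\<close> with \<open>z \<in> A\<close>.  Here \<open>z\<close> is central because \<open>x\<close> commutes with \<open>A\<close>, and primitive
  because \<open>\<Delta>(x)\<^sup>2 = x\<^sup>2 \<otimes> 1 + 1 \<otimes> x\<^sup>2\<close>; by associativity it determines the whole cocycle
  (\<open>crossed_system_classification\<close>).  Conversely every central primitive \<open>z\<close> defines a Hopf algebra
  \<open>h4_ext A z\<close> in this way (\<open>hopf_algebra_h4_ext\<close>).  So crossed systems correspond to the elements of
  \<open>ZP A\<close>.

  Unitary cocentral maps \<open>H\<^sub>4 \<rightarrow> A\<close> are trivial, again by comparing components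
  (\<open>unitary_cocentral_H4_iff\<close>), so equivalent crossed systems are equal (\<open>CS_rel_H4\<close>), which gives the
  description of \<open>H2\<close>.

  Let \<open>\<phi>\<close> be an isomorphism from \<open>h4_ext A a\<close> to \<open>h4_ext A b\<close>.  The composite of \<open>\<phi>\<close> with the inclusion of
  \<open>A\<close> and the projection to \<open>H\<^sub>4\<close> is trivial by hypothesis, so \<open>\<phi>\<close> maps \<open>A\<close> to the coinvariants of the
  projection, that is, to \<open>A\<close>; it restricts to an automorphism \<open>u\<close> of \<open>A\<close> (\<open>iso_restricts_to_base\<close>).
  Since \<open>\<phi>(g)\<close> is group-like outside \<open>A\<close> and \<open>\<phi>(x)\<close> is skew-primitive and anticommutes with \<open>\<phi>(g)\<close>, it
  follows that \<open>\<phi>(x) = \<beta> x\<close> with \<open>\<beta> \<noteq> 0\<close>; this is where the characteristic enters.  Squaring gives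
  \<open>u(a) = \<beta>\<^sup>2 b\<close> (\<open>iso_imp_ZP_rel\<close>).  Conversely \<open>u\<close> and \<open>\<beta>\<close> define an isomorphism (\<open>ZP_rel_imp_iso\<close>).

  All identities between tensors are reduced to identities between scalars: two tensors are equal iff
  all bilinear forms agree on them (\<open>tensor_eqI_forms\<close>), so a comultiplication is handled through the
  Sweedler sums \<open>sw2 t A \<phi>\<close> of bilinear maps \<open>\<phi>\<close>.
\<close>

section \<open>Tensors and multilinear forms\<close>

lemma exists_separating_form:
  assumes V: "vector_space s" and N: "module.subspace s N" and x: "x \<notin> N"
  shows "\<exists>l. Vector_Spaces.linear s (*) l \<and> (\<forall>n\<in>N. l n = 0) \<and> l x \<noteq> (0::'k::field)"
proof -
  interpret V: vector_space s by fact
  interpret VK: vector_space_pair s "(*) :: 'k \<Rightarrow> 'k \<Rightarrow> 'k"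
    using V vector_space_over_itself.vector_space_axioms by (rule vector_space_pair.intro)
  obtain B where B: "B \<subseteq> N" "V.independent B" "N \<subseteq> V.span B"
    using V.maximal_independent_subset[of N] by blast
  have sp: "V.span B = N"
    using B V.span_minimal[OF B(1)] N by auto
  then have xB: "x \<notin> V.span B"
    using x by simp
  then have "V.independent (insert x B)"
    using B(2) V.independent_insert by auto
  from VK.linear_independent_extend[OF this, of "\<lambda>v. if v = x then 1 else 0"]
  obtain l where l: "Vector_Spaces.linear s (*) l" "\<forall>v\<in>insert x B. l v = (if v = x then 1 else 0)"
    by auto
  have "x \<notin> B"
    using xB V.span_base by blast
  then have "\<And>b. b \<in> B \<Longrightarrow> l b = 0"
    using l(2) by auto
  then have "l n = 0" if "n \<in> N" for n
    using VK.linear_eq_0_on_span[OF l(1), of B n] that sp by auto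
  then show ?thesis
    using l by (intro exI[of _ l]) auto
qed

lemma bilinear_map_iff:
  "bilinear_map sA sB sC \<phi> \<longleftrightarrow> vector_space sA \<and> vector_space sB \<and> vector_space sC \<and>
    (\<forall>a a' b. \<phi> (a + a') b = \<phi> a b + \<phi> a' b) \<and> (\<forall>a b b'. \<phi> a (b + b') = \<phi> a b + \<phi> a b') \<and>
    (\<forall>c a b. \<phi> (sA c a) b = sC c (\<phi> a b)) \<and> (\<forall>c a b. \<phi> a (sB c b) = sC c (\<phi> a b))"
  unfolding bilinear_map_def Vector_Spaces.linear_iff by auto

lemma linear_image_fsum:
  assumes "Vector_Spaces.linear s t L"
  shows "L (fsum s \<phi> x) = fsum t (\<lambda>p. L (\<phi> p)) x"
proof -
  interpret Vector_Spaces.linear s t L by fact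
  show ?thesis by (simp add: fsum_def sum scale)
qed

lemma fsum_singles: "fsum fscale (\<lambda>p. Poly_Mapping.single p 1) x = x"
  using formal_expand[of x] by (simp add: fsum_def)

lemma vector_space_scalars: "vector_space ((*) :: 'k::field \<Rightarrow> 'k \<Rightarrow> 'k)"
  by (rule vector_space_over_itself.vector_space_axioms)

text \<open>A formal sum outside the subspace of relations is separated from it by a linear form, and a linear
  form that kills the relations is the same as a bilinear form.  So it suffices to test on bilinear
  forms.\<close>

lemma tensor_eqI_forms:
  assumes A: "vector_space sA" and B: "vector_space sB"
    and eq: "\<And>\<phi>. bilinear_map sA sB (*) \<phi> \<Longrightarrow>
      fsum (*) (case_prod \<phi>) x = fsum (*) (case_prod \<phi>) y"
  shows "tensor_eq sA sB x (y :: _ \<Rightarrow>\<^sub>0 'k::field)"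
proof (rule ccontr)
  assume "\<not> tensor_eq sA sB x y"
  then have "x - y \<notin> tensor_null sA sB"
    by (simp add: tensor_eq_def)
  from exists_separating_form[OF formal.vector_space_axioms _ this]
  obtain l where l: "Vector_Spaces.linear fscale (*) l"
      "\<And>n. n \<in> tensor_null sA sB \<Longrightarrow> l n = 0" "l (x - y) \<noteq> 0"
    by (auto simp: tensor_null_def formal.subspace_span)
  interpret l: Vector_Spaces.linear fscale "(*)" l by fact
  have l_eq: "l u = l v" if "tensor_eq sA sB u v" for u v
    using l(2)[of "u - v"] that by (simp add: tensor_eq_def l.diff)
  have "bilinear_map sA sB (*) (\<lambda>a b. l (a \<otimes> b))"
    unfolding bilinear_map_iff
    using A B vector_space_scalars tensor_eq_rel[THEN l_eq] by (auto simp: l.add l.scale)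
  moreover have "fsum (*) (\<lambda>(a, b). l (a \<otimes> b)) u = l u" for u
    using linear_image_fsum[OF l(1), of "\<lambda>p. Poly_Mapping.single p 1" u]
    by (simp add: fsum_singles split_def)
  ultimately have "l x = l y"
    using eq by fastforce
  then show False
    using l(3) by (simp add: l.diff)
qed

definition trilinear_map where
  "trilinear_map s t \<phi> \<longleftrightarrow> (\<forall>c. bilinear_map s s t (\<lambda>a b. \<phi> a b c)) \<and> (\<forall>a. bilinear_map s s t (\<phi> a))"

lemma tensor3_eq_fsum:
  assumes tri: "trilinear_map s t \<phi>" and eq: "tensor3_eq s x y"
  shows "fsum t (\<lambda>(a, b, c). \<phi> a b c) x = fsum t (\<lambda>(a, b, c). \<phi> a b c) y"
proof -
  have T: "vector_space t"
    using tri by (simp add: trilinear_map_def bilinear_map_iff)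
  interpret T: vector_space t by fact
  let ?L = "fsum t (\<lambda>(a, b, c). \<phi> a b c)"
  have L: "Vector_Spaces.linear fscale t ?L"
    by (rule linear_fsum[OF T])
  have null: "fsum t (case_prod \<psi>) n = 0" if "bilinear_map s s t \<psi>" "n \<in> tensor_null s s" for \<psi> n
    using tensor_eq_fsum[OF that(1) T, of n 0] that(2) by (simp add: tensor_eq_def fsum_linear[OF T])
  have 1: "?L (fsum fscale (\<lambda>(a, b). Poly_Mapping.single (a, b, c) 1) n) = 0"
    if "n \<in> tensor_null s s" for n c
    using null[of "\<lambda>a b. \<phi> a b c", OF _ that] tri
    unfolding linear_image_fsum[OF L] by (simp add: trilinear_map_def fsum_single[OF T] split_def)
  have 2: "?L (fsum fscale (\<lambda>(b, c). Poly_Mapping.single (a, b, c) 1) n) = 0"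
    if "n \<in> tensor_null s s" for n a
    using null[of "\<phi> a", OF _ that] tri
    unfolding linear_image_fsum[OF L] by (simp add: trilinear_map_def fsum_single[OF T] split_def)
  have "?L (x - y) = 0"
    using eq unfolding tensor3_eq_def
  proof (induction rule: formal.span_induct)
    case base
    show ?case by (auto simp: formal.subspace_def fsum_linear[OF T])
  next
    case (step z)
    then show ?case using 1 2 by auto
  qed
  then show ?thesis
    by (simp add: fsum_linear[OF T])
qed

text \<open>The argument of \<open>tensor_eqI_forms\<close>: a linear form kills the relations in the first two and in the
  last two factors iff it comes from a trilinear form.\<close>

lemma tensor3_eqI_forms:
  assumes A: "vector_space s"
    and eq: "\<And>\<phi>. trilinear_map s (*) \<phi> \<Longrightarrow>
      fsum (*) (\<lambda>(a, b, c). \<phi> a b c) x = fsum (*) (\<lambda>(a, b, c). \<phi> a b c) y"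
  shows "tensor3_eq s x (y :: _ \<Rightarrow>\<^sub>0 'k::field)"
proof (rule ccontr)
  let ?l12 = "\<lambda>c. fsum fscale (\<lambda>(a, b). Poly_Mapping.single (a, b, c) (1::'k))"
  let ?l23 = "\<lambda>a. fsum fscale (\<lambda>(b, c). Poly_Mapping.single (a, b, c) (1::'k))"
  let ?N = "formal.span ({?l12 c n | n c. n \<in> tensor_null s s} \<union> {?l23 a n | n a. n \<in> tensor_null s s})"
  assume "\<not> tensor3_eq s x y"
  then have "x - y \<notin> ?N"
    by (simp add: tensor3_eq_def)
  from exists_separating_form[OF formal.vector_space_axioms _ this]
  obtain l where l: "Vector_Spaces.linear fscale (*) l"
      "\<And>n. n \<in> ?N \<Longrightarrow> l n = 0" "l (x - y) \<noteq> 0"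
    by (auto simp: formal.subspace_span)
  interpret l: Vector_Spaces.linear fscale "(*)" l by fact
  note F = formal.vector_space_axioms
  have l12: "l (?l12 c u) = l (?l12 c v)" if "tensor_eq s s u v" for u v c
  proof -
    have "?l12 c (u - v) \<in> ?N"
      using that by (intro formal.span_base) (auto simp: tensor_eq_def)
    then show ?thesis
      using l(2) by (fastforce simp: fsum_linear[OF F] l.diff)
  qed
  have l23: "l (?l23 a u) = l (?l23 a v)" if "tensor_eq s s u v" for u v a
  proof -
    have "?l23 a (u - v) \<in> ?N"
      using that by (intro formal.span_base) (auto simp: tensor_eq_def)
    then show ?thesis
      using l(2) by (fastforce simp: fsum_linear[OF F] l.diff)
  qed
  let ?\<phi> = "\<lambda>a b c. l (Poly_Mapping.single (a, b, c) 1)"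
  have "trilinear_map s (*) ?\<phi>"
    unfolding trilinear_map_def bilinear_map_iff
    using A vector_space_scalars tensor_eq_rel[where sA = s and sB = s, THEN l12]
      tensor_eq_rel[where sA = s and sB = s, THEN l23]
    by (auto simp: l.add l.scale fsum_linear[OF F] fsum_single[OF F])
  moreover have "fsum (*) (\<lambda>(a, b, c). ?\<phi> a b c) u = l u" for u
    using linear_image_fsum[OF l(1), of "\<lambda>p. Poly_Mapping.single p 1" u]
    by (simp add: fsum_singles split_def)
  ultimately have "l x = l y"
    using eq by fastforce
  then show False
    using l(3) by (simp add: l.diff)
qed

section \<open>Calculus of Sweedler sums\<close>

lemma sw2_fun_add:
  assumes "vector_space t"
  shows "sw2 t A (\<lambda>a b. \<phi> a b + \<psi> a b) x = sw2 t A \<phi> x + sw2 t A \<psi> x"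
proof -
  interpret vector_space t by fact
  show ?thesis by (simp add: sw2_def fsum_def split_def scale_right_distrib sum.distrib)
qed

lemma sw2_fun_minus:
  assumes "vector_space t"
  shows "sw2 t A (\<lambda>a b. - \<phi> a b) x = - sw2 t A \<phi> x"
proof -
  interpret vector_space t by fact
  show ?thesis by (simp add: sw2_def fsum_def split_def sum_negf)
qed

lemma sw2_fun_diff:
  assumes "vector_space t"
  shows "sw2 t A (\<lambda>a b. \<phi> a b - \<psi> a b) x = sw2 t A \<phi> x - sw2 t A \<psi> x"
  using sw2_fun_add[OF assms, of A \<phi> "\<lambda>a b. - \<psi> a b"] sw2_fun_minus[OF assms] by simp

lemma sw2_fun_scale:
  assumes "vector_space t"
  shows "sw2 t A (\<lambda>a b. t c (\<phi> a b)) x = t c (sw2 t A \<phi> x)"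
proof -
  interpret vector_space t by fact
  show ?thesis
    by (simp add: sw2_def fsum_def split_def scale_sum_right mult.commute)
qed

lemma sw2_fun_zero:
  assumes "vector_space t"
  shows "sw2 t A (\<lambda>a b. 0) x = 0"
proof -
  interpret vector_space t by fact
  show ?thesis by (simp add: sw2_def fsum_def split_def)
qed

lemmas sw2_fun_linear = sw2_fun_add sw2_fun_minus sw2_fun_diff sw2_fun_scale sw2_fun_zero

lemma linear_image_sw2:
  "Vector_Spaces.linear s t L \<Longrightarrow> L (sw2 s A \<phi> a) = sw2 t A (\<lambda>a1 a2. L (\<phi> a1 a2)) a"
  by (simp add: sw2_def linear_image_fsum split_def)

lemma fsum_sw2:
  "vector_space t \<Longrightarrow> fsum t \<psi> (sw2 fscale A \<theta> a) = sw2 t A (\<lambda>a1 a2. fsum t \<psi> (\<theta> a1 a2)) a"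
  by (rule linear_image_sw2[OF linear_fsum])

text \<open>For bilinear \<open>\<phi>\<close>, a Sweedler sum depends only on the class of the comultiplication and may be
  computed from any representative.\<close>

lemma sw2_comult:
  assumes "bilinear_map (hscale A) (hscale A) t \<phi>"
    and "tensor_eq (hscale A) (hscale A) (hcomult A x) u"
  shows "sw2 t A \<phi> x = fsum t (case_prod \<phi>) u"
  using tensor_eq_fsum[OF assms(1) _ assms(2)] assms(1)
  by (simp add: sw2_def bilinear_map_iff)

lemma bilinear_vector_space: "bilinear_map sA sB sC \<phi> \<Longrightarrow> vector_space sC"
  by (simp add: bilinear_map_iff)

context hopf_algebra
begin

lemmas is_vs [simp] = vector_space

sublocale V: vector_space "hscale A"
  by (rule is_vs)

lemma mult_linear [simp]:
  "hmult A (a + b) c = hmult A a c + hmult A b c"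
  "hmult A c (a + b) = hmult A c a + hmult A c b"
  "hmult A (hscale A r a) c = hscale A r (hmult A a c)"
  "hmult A c (hscale A r a) = hscale A r (hmult A c a)"
  "hmult A (- a) c = - hmult A a c"
  "hmult A c (- a) = - hmult A c a"
  "hmult A (a - b) c = hmult A a c - hmult A b c"
  "hmult A c (a - b) = hmult A c a - hmult A c b"
  "hmult A 0 c = 0"
  "hmult A c 0 = 0"
proof -
  interpret l: Vector_Spaces.linear "hscale A" "hscale A" "hmult A c"
    using mult_bilinear by (simp add: bilinear_map_def)
  interpret r: Vector_Spaces.linear "hscale A" "hscale A" "\<lambda>a. hmult A a c"
    using mult_bilinear by (simp add: bilinear_map_def)
  show
    "hmult A (a + b) c = hmult A a c + hmult A b c"
    "hmult A c (a + b) = hmult A c a + hmult A c b"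
    "hmult A (hscale A r a) c = hscale A r (hmult A a c)"
    "hmult A c (hscale A r a) = hscale A r (hmult A c a)"
    "hmult A (- a) c = - hmult A a c"
    "hmult A c (- a) = - hmult A c a"
    "hmult A (a - b) c = hmult A a c - hmult A b c"
    "hmult A c (a - b) = hmult A c a - hmult A c b"
    "hmult A 0 c = 0"
    "hmult A c 0 = 0"
    by (rule l.add r.add l.scale r.scale l.neg r.neg l.diff r.diff l.zero r.zero)+
qed

lemma counit_lin [simp]:
  "hcounit A (a + b) = hcounit A a + hcounit A b"
  "hcounit A (hscale A r a) = r * hcounit A a"
  "hcounit A (- a) = - hcounit A a"
  "hcounit A (a - b) = hcounit A a - hcounit A b"
  "hcounit A 0 = 0"
proof -
  interpret l: Vector_Spaces.linear "hscale A" "(*)" "hcounit A"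
    by (rule counit_linear)
  show "hcounit A (a + b) = hcounit A a + hcounit A b"
    "hcounit A (hscale A r a) = r * hcounit A a"
    "hcounit A (- a) = - hcounit A a"
    "hcounit A (a - b) = hcounit A a - hcounit A b"
    "hcounit A 0 = 0"
    by (rule l.add l.scale l.neg l.diff l.zero)+
qed

declare mult_one_left [simp] mult_one_right [simp] counit_one [simp] counit_mult [simp]

lemma linear_sw2:
  assumes "bilinear_map (hscale A) (hscale A) t \<phi>"
  shows "Vector_Spaces.linear (hscale A) t (sw2 t A \<phi>)"
proof -
  note T = bilinear_vector_space[OF assms]
  show ?thesis
    unfolding Vector_Spaces.linear_iff
    using sw2_comult[OF assms comult_add] sw2_comult[OF assms comult_scale] T
    by (auto simp: fsum_linear[OF T]) (auto simp: sw2_def split_def)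
qed

lemma sw2_linear:
  assumes "bilinear_map (hscale A) (hscale A) t \<phi>"
  shows "sw2 t A \<phi> (a + b) = sw2 t A \<phi> a + sw2 t A \<phi> b"
    and "sw2 t A \<phi> (hscale A r a) = t r (sw2 t A \<phi> a)"
    and "sw2 t A \<phi> (- a) = - sw2 t A \<phi> a"
    and "sw2 t A \<phi> 0 = 0"
proof -
  interpret Vector_Spaces.linear "hscale A" t "sw2 t A \<phi>"
    by (rule linear_sw2[OF assms])
  show "sw2 t A \<phi> (a + b) = sw2 t A \<phi> a + sw2 t A \<phi> b"
    "sw2 t A \<phi> (hscale A r a) = t r (sw2 t A \<phi> a)"
    "sw2 t A \<phi> (- a) = - sw2 t A \<phi> a"
    "sw2 t A \<phi> 0 = 0"
    by (rule add scale neg zero)+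
qed

lemma sw2_coassoc:
  assumes "trilinear_map (hscale A) t \<phi>"
  shows "sw2 t A (\<lambda>b a3. sw2 t A (\<lambda>a1 a2. \<phi> a1 a2 a3) b) a =
    sw2 t A (\<lambda>a1 b. sw2 t A (\<phi> a1) b) a"
proof -
  have T: "vector_space t"
    using assms by (auto simp: trilinear_map_def bilinear_map_iff)
  interpret T: vector_space t by fact
  show ?thesis
    using tensor3_eq_fsum[OF assms coassoc, of a]
    by (simp add: fsum_sw2[OF T] fsum_single[OF T])
qed

lemma sw2_counit:
  assumes "Vector_Spaces.linear (hscale A) t \<psi>"
  shows "sw2 t A (\<lambda>a1 a2. t (hcounit A a1) (\<psi> a2)) a = \<psi> a"
    and "sw2 t A (\<lambda>a1 a2. t (hcounit A a2) (\<psi> a1)) a = \<psi> a"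
proof -
  have *: "\<psi> (hscale A r b) = t r (\<psi> b)" for r b
    using assms by (simp add: Vector_Spaces.linear_iff)
  show "sw2 t A (\<lambda>a1 a2. t (hcounit A a1) (\<psi> a2)) a = \<psi> a"
    "sw2 t A (\<lambda>a1 a2. t (hcounit A a2) (\<psi> a1)) a = \<psi> a"
    using linear_image_sw2[OF assms, of A "\<lambda>a1 a2. hscale A (hcounit A a1) a2" a]
      linear_image_sw2[OF assms, of A "\<lambda>a1 a2. hscale A (hcounit A a2) a1" a]
    by (simp_all add: counit_left counit_right *)
qed

lemma sw2_one:
  assumes "bilinear_map (hscale A) (hscale A) t \<phi>"
  shows "sw2 t A \<phi> (hone A) = \<phi> (hone A) (hone A)"
proof -
  note T = bilinear_vector_space[OF assms]
  interpret vector_space t by fact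
  show ?thesis
    using sw2_comult[OF assms comult_one] by (simp add: fsum_single[OF T])
qed

lemma sw2_mult:
  assumes "bilinear_map (hscale A) (hscale A) t \<phi>"
  shows "sw2 t A \<phi> (hmult A a b) =
    sw2 t A (\<lambda>a1 a2. sw2 t A (\<lambda>b1 b2. \<phi> (hmult A a1 b1) (hmult A a2 b2)) b) a"
proof -
  note T = bilinear_vector_space[OF assms]
  interpret vector_space t by fact
  show ?thesis
    using sw2_comult[OF assms comult_mult] by (simp add: fsum_single[OF T] fsum_sw2[OF T])
qed

lemma sw2_primitive:
  assumes "bilinear_map (hscale A) (hscale A) t \<phi>" and "z \<in> primitives A"
  shows "sw2 t A \<phi> z = \<phi> z (hone A) + \<phi> (hone A) z"
proof -
  note T = bilinear_vector_space[OF assms(1)]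
  interpret vector_space t by fact
  show ?thesis
    using sw2_comult[OF assms(1), of z] assms(2)
    by (simp add: primitives_def fsum_single[OF T] fsum_linear[OF T])
qed

lemma primitiveI_forms:
  assumes "\<And>\<phi>. bilinear_map (hscale A) (hscale A) (*) \<phi> \<Longrightarrow>
    sw2 (*) A \<phi> z = \<phi> z (hone A) + \<phi> (hone A) z"
  shows "z \<in> primitives A"
  unfolding primitives_def mem_Collect_eq using is_vs is_vs
proof (rule tensor_eqI_forms)
  fix \<phi> assume "bilinear_map (hscale A) (hscale A) (*) \<phi>"
  then show "fsum (*) (case_prod \<phi>) (hcomult A z) =
      fsum (*) (case_prod \<phi>) (z \<otimes> hone A + hone A \<otimes> z)"
    using assms[of \<phi>]
    by (simp add: sw2_def fsum_single[OF vector_space_scalars] fsum_linear[OF vector_space_scalars])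
qed

lemma counit_primitive:
  assumes "z \<in> primitives A"
  shows "hcounit A z = 0"
proof -
  have "sw2 (*) A (\<lambda>a b. hcounit A a * hcounit A b) z = hcounit A z + hcounit A z"
    by (subst sw2_primitive) (use assms vector_space_scalars in \<open>auto simp: bilinear_map_iff algebra_simps\<close>)
  moreover have "sw2 (*) A (\<lambda>a b. hcounit A a * hcounit A b) z = hcounit A z"
    by (rule sw2_counit[OF counit_linear])
  ultimately have "hcounit A z + hcounit A z = hcounit A z + 0"
    by simp
  then show ?thesis by (simp only: add_left_cancel)
qed

text \<open>The antipode is the convolution inverse of the identity, and inverses in a monoid are unique:
  \<open>S = S * (id * T) = (S * id) * T = T\<close>.\<close>

lemma antipode_unique:
  assumes S: "is_antipode A S" and T: "is_antipode A T"
  shows "S = T"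
proof
  fix a
  let ?s = "sw2 (hscale A) A"
  have lin: "S (x + y) = S x + S y" "S (hscale A c x) = hscale A c (S x)"
    "T (x + y) = T x + T y" "T (hscale A c x) = hscale A c (T x)" for x y c
    using S T by (auto simp: is_antipode_def Vector_Spaces.linear_iff)
  have L: "Vector_Spaces.linear (hscale A) (hscale A) (hmult A c)"
    and R: "Vector_Spaces.linear (hscale A) (hscale A) (\<lambda>a. hmult A a c)" for c
    using mult_bilinear by (auto simp: bilinear_map_def)
  have "S a = ?s (\<lambda>a1 a2. hscale A (hcounit A a2) (S a1)) a"
    using S by (intro sw2_counit(2)[symmetric]) (simp add: is_antipode_def)
  also have "\<dots> = ?s (\<lambda>a1 b. hmult A (S a1) (hscale A (hcounit A b) (hone A))) a"
    by simp
  also have "\<dots> = ?s (\<lambda>a1 b. hmult A (S a1) (?s (\<lambda>a2 a3. hmult A a2 (T a3)) b)) a"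
    using T by (simp only: is_antipode_def)
  also have "\<dots> = ?s (\<lambda>a1 b. ?s (\<lambda>a2 a3. hmult A (S a1) (hmult A a2 (T a3))) b) a"
    by (simp only: linear_image_sw2[OF L])
  also have "\<dots> = ?s (\<lambda>b a3. ?s (\<lambda>a1 a2. hmult A (S a1) (hmult A a2 (T a3))) b) a"
    by (rule sw2_coassoc[symmetric]) (simp add: trilinear_map_def bilinear_map_iff lin)
  also have "\<dots> = ?s (\<lambda>b a3. hmult A (?s (\<lambda>a1 a2. hmult A (S a1) a2) b) (T a3)) a"
    by (simp only: linear_image_sw2[OF R] mult_assoc)
  also have "\<dots> = ?s (\<lambda>b a3. hmult A (hscale A (hcounit A b) (hone A)) (T a3)) a"
    using S by (simp only: is_antipode_def)
  also have "\<dots> = ?s (\<lambda>a1 a2. hscale A (hcounit A a1) (T a2)) a"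
    by simp
  also have "\<dots> = T a"
    using T by (intro sw2_counit(1)) (simp add: is_antipode_def)
  finally show "S a = T a" .
qed

lemma is_antipode_antipode: "is_antipode A (antipode A)"
  unfolding antipode_def using antipode_exists antipode_unique by (metis theI')

lemma antipode_scale_one: "antipode A (hscale A c (hone A)) = hscale A c (hone A)"
proof -
  let ?S = "antipode A"
  have lin: "?S (x + y) = ?S x + ?S y" "?S (hscale A c x) = hscale A c (?S x)" for x y c
    using is_antipode_antipode by (auto simp: is_antipode_def Vector_Spaces.linear_iff)
  have "hmult A (?S (hone A)) (hone A) = sw2 (hscale A) A (\<lambda>a1 a2. hmult A (?S a1) a2) (hone A)"
    by (rule sw2_one[symmetric]) (simp add: bilinear_map_iff lin)
  also have "\<dots> = hscale A (hcounit A (hone A)) (hone A)"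
    using is_antipode_antipode by (simp only: is_antipode_def)
  finally show ?thesis by (simp add: lin)
qed

end

text \<open>By \<open>tensor_eqI_forms\<close>, the axioms about \<open>\<Delta>\<close> need only be checked after applying forms with values
  in the scalars.\<close>

lemma hopf_algebraI_forms:
  fixes A :: "('k::field, 'a::ab_group_add) hopf"
  assumes V: "vector_space (hscale A)"
    and "bilinear_map (hscale A) (hscale A) (hscale A) (hmult A)"
    and "\<And>a b c. hmult A (hmult A a b) c = hmult A a (hmult A b c)"
    and "\<And>a. hmult A (hone A) a = a"
    and "\<And>a. hmult A a (hone A) = a"
    and "Vector_Spaces.linear (hscale A) (*) (hcounit A)"
    and linear: "\<And>\<phi>. bilinear_map (hscale A) (hscale A) (*) \<phi> \<Longrightarrow>
      Vector_Spaces.linear (hscale A) (*) (sw2 (*) A \<phi>)"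
    and coassoc: "\<And>\<phi> a. trilinear_map (hscale A) (*) \<phi> \<Longrightarrow>
      sw2 (*) A (\<lambda>b a3. sw2 (*) A (\<lambda>a1 a2. \<phi> a1 a2 a3) b) a = sw2 (*) A (\<lambda>a1 b. sw2 (*) A (\<phi> a1) b) a"
    and "\<And>a. sw2 (hscale A) A (\<lambda>a1 a2. hscale A (hcounit A a1) a2) a = a"
    and "\<And>a. sw2 (hscale A) A (\<lambda>a1 a2. hscale A (hcounit A a2) a1) a = a"
    and one: "\<And>\<phi>. bilinear_map (hscale A) (hscale A) (*) \<phi> \<Longrightarrow>
      sw2 (*) A \<phi> (hone A) = \<phi> (hone A) (hone A)"
    and mult: "\<And>\<phi> a b. bilinear_map (hscale A) (hscale A) (*) \<phi> \<Longrightarrow> sw2 (*) A \<phi> (hmult A a b) =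
      sw2 (*) A (\<lambda>a1 a2. sw2 (*) A (\<lambda>b1 b2. \<phi> (hmult A a1 b1) (hmult A a2 b2)) b) a"
    and "hcounit A (hone A) = 1"
    and "\<And>a b. hcounit A (hmult A a b) = hcounit A a * hcounit A b"
    and "\<exists>S. is_antipode A S"
  shows "hopf_algebra A"
proof (rule hopf_algebra.intro)
  note K = vector_space_scalars[where 'k = 'k]
  note simps = fsum_sw2[OF K] fsum_single[OF K] fsum_linear[OF K]
  fix a b :: 'a and r :: 'k
  have sw: "fsum (*) (case_prod \<phi>) (hcomult A x) = sw2 (*) A \<phi> x" for \<phi> x
    by (simp add: sw2_def split_def)
  show "tensor_eq (hscale A) (hscale A) (hcomult A (a + b)) (hcomult A a + hcomult A b)"
    using linear by (intro tensor_eqI_forms V) (simp add: simps sw Vector_Spaces.linear_iff)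
  show "tensor_eq (hscale A) (hscale A) (hcomult A (hscale A r a)) (fscale r (hcomult A a))"
    using linear by (intro tensor_eqI_forms V) (simp add: simps sw Vector_Spaces.linear_iff)
  show "tensor3_eq (hscale A)
      (sw2 fscale A (\<lambda>b a3. sw2 fscale A (\<lambda>a1 a2. Poly_Mapping.single (a1, a2, a3) 1) b) a)
      (sw2 fscale A (\<lambda>a1 b. sw2 fscale A (\<lambda>a2 a3. Poly_Mapping.single (a1, a2, a3) 1) b) a)"
    using coassoc by (intro tensor3_eqI_forms V) (simp add: simps)
  show "tensor_eq (hscale A) (hscale A) (hcomult A (hone A)) (hone A \<otimes> hone A)"
    using one by (intro tensor_eqI_forms V) (simp add: simps sw)
  show "tensor_eq (hscale A) (hscale A) (hcomult A (hmult A a b))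
      (sw2 fscale A (\<lambda>a1 a2. sw2 fscale A (\<lambda>b1 b2. hmult A a1 b1 \<otimes> hmult A a2 b2) b) a)"
    using mult by (intro tensor_eqI_forms V) (simp add: simps sw)
qed (fact assms)+

lemma coalgebra_map_sw2:
  assumes f: "coalgebra_map A B f" and bil: "bilinear_map (hscale B) (hscale B) t \<phi>"
  shows "sw2 t B \<phi> (f a) = sw2 t A (\<lambda>a1 a2. \<phi> (f a1) (f a2)) a"
proof -
  note T = bilinear_vector_space[OF bil]
  interpret vector_space t by fact
  have "tensor_eq (hscale B) (hscale B) (hcomult B (f a)) (sw2 fscale A (\<lambda>a1 a2. f a1 \<otimes> f a2) a)"
    using f by (simp add: coalgebra_map_def)
  from sw2_comult[OF bil this] show ?thesis
    by (simp add: fsum_single[OF T] fsum_sw2[OF T])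
qed

lemma hopf_homI_forms:
  fixes A :: "('k::field, 'a::ab_group_add) hopf"
  assumes lin: "Vector_Spaces.linear (hscale A) (hscale B) f"
    and sw: "\<And>\<phi> a. bilinear_map (hscale B) (hscale B) (*) \<phi> \<Longrightarrow>
      sw2 (*) B \<phi> (f a) = sw2 (*) A (\<lambda>a1 a2. \<phi> (f a1) (f a2)) a"
    and "\<And>a. hcounit B (f a) = hcounit A a" "f (hone A) = hone B"
    and "\<And>a b. f (hmult A a b) = hmult B (f a) (f b)"
  shows "hopf_hom A B f"
proof -
  note K = vector_space_scalars[where 'k = 'k]
  have V: "vector_space (hscale B)"
    using lin by (simp add: Vector_Spaces.linear_iff)
  have "tensor_eq (hscale B) (hscale B)
       (hcomult B (f a)) (sw2 fscale A (\<lambda>a1 a2. f a1 \<otimes> f a2) a)" for a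
  proof (rule tensor_eqI_forms[OF V V])
    fix \<phi> assume "bilinear_map (hscale B) (hscale B) (*) \<phi>"
    from sw[OF this, of a]
    show "fsum (*) (case_prod \<phi>) (hcomult B (f a)) =
        fsum (*) (case_prod \<phi>) (sw2 fscale A (\<lambda>a1 a2. f a1 \<otimes> f a2) a)"
      by (simp add: fsum_sw2[OF K] fsum_single[OF K]) (simp add: sw2_def split_def)
  qed
  then show ?thesis
    using assms by (simp add: hopf_hom_def coalgebra_map_def)
qed

lemma hopf_homD:
  assumes "hopf_hom A B f"
  shows "Vector_Spaces.linear (hscale A) (hscale B) f" "f (x + y) = f x + f y"
    "f (hscale A c x) = hscale B c (f x)" "f (- x) = - f x"
    "hcounit B (f x) = hcounit A x" "f (hone A) = hone B" "f (hmult A x y) = hmult B (f x) (f y)"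
    "coalgebra_map A B f"
proof -
  show L: "Vector_Spaces.linear (hscale A) (hscale B) f"
    using assms by (simp add: hopf_hom_def coalgebra_map_def)
  interpret Vector_Spaces.linear "hscale A" "hscale B" f by fact
  show "f (x + y) = f x + f y" "f (hscale A c x) = hscale B c (f x)" "f (- x) = - f x"
    by (rule add scale neg)+
qed (use assms in \<open>auto simp: hopf_hom_def coalgebra_map_def\<close>)

lemma hopf_hom_sw2:
  "hopf_hom A B f \<Longrightarrow> bilinear_map (hscale B) (hscale B) t \<phi> \<Longrightarrow>
    sw2 t B \<phi> (f a) = sw2 t A (\<lambda>a1 a2. \<phi> (f a1) (f a2)) a"
  by (rule coalgebra_map_sw2[OF hopf_homD(8)])

lemma hopf_hom_comp:
  assumes f: "hopf_hom A B f" and g: "hopf_hom B C g"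
  shows "hopf_hom A C (g \<circ> f)"
proof (rule hopf_homI_forms)
  show "Vector_Spaces.linear (hscale A) (hscale C) (g \<circ> f)"
    using hopf_homD(1)[OF f] hopf_homD(1)[OF g] by (simp add: Vector_Spaces.linear_iff)
  fix \<phi> a assume \<phi>: "bilinear_map (hscale C) (hscale C) (*) \<phi>"
  then have "bilinear_map (hscale B) (hscale B) (*) (\<lambda>x y. \<phi> (g x) (g y))"
    using hopf_homD(1)[OF g] by (simp add: bilinear_map_iff Vector_Spaces.linear_iff)
  then show "sw2 (*) C \<phi> ((g \<circ> f) a) = sw2 (*) A (\<lambda>a1 a2. \<phi> ((g \<circ> f) a1) ((g \<circ> f) a2)) a"
    using hopf_hom_sw2[OF g \<phi>] hopf_hom_sw2[OF f] by simp
qed (simp_all add: hopf_homD[OF f] hopf_homD[OF g])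

lemma hopf_iso_comp: "hopf_iso A B f \<Longrightarrow> hopf_iso B C g \<Longrightarrow> hopf_iso A C (g \<circ> f)"
  by (auto simp: hopf_iso_def intro: hopf_hom_comp bij_comp)

lemma hopf_iso_inv:
  assumes "hopf_iso A B f"
  shows "hopf_iso B A (inv f)"
proof -
  have hom: "hopf_hom A B f" and bij: "bij f"
    using assms by (auto simp: hopf_iso_def)
  note f = hopf_homD[OF hom]
  have f_inv [simp]: "f (inv f y) = y" and inv_f [simp]: "inv f (f x) = x" for x y
    using bij by (auto simp: bij_def surj_f_inv_f)
  have eqI: "x = y" if "f x = f y" for x y
    using bij that by (auto simp: bij_def inj_def)
  have lin: "Vector_Spaces.linear (hscale B) (hscale A) (inv f)"
    using f(1) by (auto simp: Vector_Spaces.linear_iff intro!: eqI)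
  have "hopf_hom B A (inv f)"
  proof (rule hopf_homI_forms[OF lin])
    fix \<phi> a assume \<phi>: "bilinear_map (hscale A) (hscale A) (*) \<phi>"
    have "bilinear_map (hscale B) (hscale B) (*) (\<lambda>x y. \<phi> (inv f x) (inv f y))"
      using \<phi> lin by (simp add: bilinear_map_iff Vector_Spaces.linear_iff)
    from hopf_hom_sw2[OF hom this, of "inv f a"]
    show "sw2 (*) A \<phi> (inv f a) = sw2 (*) B (\<lambda>x y. \<phi> (inv f x) (inv f y)) a"
      by simp
  next
    fix a b
    show "hcounit A (inv f a) = hcounit B a"
      using f(5)[of "inv f a"] by simp
    show "inv f (hmult B a b) = hmult A (inv f a) (inv f b)"
      by (rule eqI) (simp add: f)
    show "inv f (hone B) = hone A"
      by (rule eqI) (simp add: f)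
  qed
  then show ?thesis
    using bij by (simp add: hopf_iso_def bij_imp_bij_inv)
qed

lemma hopf_iso_id:
  assumes "hopf_algebra A"
  shows "hopf_iso A A id"
proof -
  interpret hopf_algebra A by fact
  show ?thesis
    unfolding hopf_iso_def
    by (auto intro!: hopf_homI_forms simp: Vector_Spaces.linear_iff)
qed

section \<open>Crossed products with Sweedler's Hopf algebra\<close>

lemma bilinear_comp:
  assumes "bilinear_map sA sB sC \<phi>" "Vector_Spaces.linear s sA f" "Vector_Spaces.linear t sB g"
  shows "bilinear_map s t sC (\<lambda>a b. \<phi> (f a) (g b))"
  using assms by (simp add: bilinear_map_iff Vector_Spaces.linear_iff)

lemma axis_linear [simp]:
  "axis i (a + b) = axis i a + axis i (b :: 'a::ab_group_add)"
  "axis i (- a) = - axis i a"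
  "axis i (a - b) = axis i a - axis i b"
  "axis i (0 :: 'a) = 0"
  by (auto simp: axis_def vec_eq_iff)

lemma vec_h4_expand:
  "v = axis B1 (v $ B1) + axis Bg (v $ Bg) + axis Bx (v $ Bx) + axis Bgx (v $ Bgx :: 'a::ab_group_add)"
  by (simp add: vec_eq_iff all_h4)

lemma crossed_product_sel [simp]:
  "hscale (crossed_product A H act f) = vscale A"
  "hcomult (crossed_product A H act f) v = (\<Sum>i\<in>UNIV. sw2 fscale A (\<lambda>a1 a2.
    sw2 fscale H (\<lambda>h1 h2. cten A a1 h1 \<otimes> cten A a2 h2) (axis i 1)) (v $ i))"
  by (simp_all add: crossed_product_def)

context hopf_algebra
begin

lemma is_vs_vscale [simp]: "vector_space (vscale A)"
  by (rule vector_space_vscale[OF is_vs])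

sublocale W: vector_space "vscale A :: 'k \<Rightarrow> 'a ^ h4 \<Rightarrow> 'a ^ h4"
  by (rule is_vs_vscale)

lemma cten_axis [simp]: "cten A a (axis i 1) = axis i a"
  by (simp add: cten_def vec_eq_iff axis_def)

lemma vscale_axis [simp]: "vscale A c (axis i a) = axis i (hscale A c a)"
  by (simp add: vscale_def vec_eq_iff axis_def)

lemma vscale_nth [simp]: "vscale A c v $ i = hscale A c (v $ i)"
  by (simp add: vscale_def)

lemma cten_nth [simp]: "cten A a h $ i = hscale A (h $ i) a"
  by (simp add: cten_def)

lemma linear_axis: "Vector_Spaces.linear (hscale A) (vscale A) (axis i)"
  by (simp add: Vector_Spaces.linear_iff)

lemma linear_nth: "Vector_Spaces.linear (vscale A) (hscale A) (\<lambda>v. v $ i)"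
  by (simp add: Vector_Spaces.linear_iff)

text \<open>The coalgebra structure of a crossed product is that of \<open>A \<otimes> H\<^sub>4\<close>, whatever the action and the
  cocycle: the six summands come from the six terms of \<open>\<Delta>\<close> on the basis of \<open>H\<^sub>4\<close>.\<close>

lemma sw2_crossed_product:
  assumes T: "vector_space t"
  shows "sw2 t (crossed_product A H4 act f) \<phi> v =
    sw2 t A (\<lambda>a b. \<phi> (axis B1 a) (axis B1 b)) (v $ B1) +
    sw2 t A (\<lambda>a b. \<phi> (axis Bg a) (axis Bg b)) (v $ Bg) +
    (sw2 t A (\<lambda>a b. \<phi> (axis Bx a) (axis B1 b)) (v $ Bx) +
     sw2 t A (\<lambda>a b. \<phi> (axis Bg a) (axis Bx b)) (v $ Bx)) +
    (sw2 t A (\<lambda>a b. \<phi> (axis Bgx a) (axis Bg b)) (v $ Bgx) +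
     sw2 t A (\<lambda>a b. \<phi> (axis B1 a) (axis Bgx b)) (v $ Bgx))"
proof -
  interpret vector_space t by fact
  have "sw2 t (crossed_product A H4 act f) \<phi> v = fsum t (\<lambda>(v, w). \<phi> v w) (\<Sum>i\<in>UNIV.
      sw2 fscale A (\<lambda>a1 a2. sw2 fscale H4 (\<lambda>h1 h2. cten A a1 h1 \<otimes> cten A a2 h2) (axis i 1)) (v $ i))"
    by (subst sw2_def) (simp add: split_def)
  then show ?thesis
    by (simp add: fsum_linear[OF T] fsum_sw2[OF T] fsum_single[OF T] sw2_H4[OF T] UNIV_h4 sw2_fun_add[OF T])
qed

lemma counit_crossed_product [simp]:
  "hcounit (crossed_product A H4 act f) v = hcounit A (v $ B1) + hcounit A (v $ Bg)"
  by (simp add: crossed_product_def UNIV_h4 H4_sel)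

lemma hone_crossed_product [simp]: "hone (crossed_product A H4 act f) = axis B1 (hone A)"
  by (simp add: crossed_product_def H4_sel(2))

end

definition triv_act :: "('k::field, 'a::ab_group_add) hopf \<Rightarrow> 'k ^ h4 \<Rightarrow> 'a \<Rightarrow> 'a"
  where "triv_act A h a = hscale A (hcounit H4 h) a"

text \<open>The cocycle of the extension in which \<open>g\<close> and \<open>x\<close> satisfy \<open>g\<^sup>2 = 1\<close>, \<open>x g = - g x\<close> and \<open>x\<^sup>2 = z\<close>: it
  is \<open>\<epsilon> \<otimes> \<epsilon>\<close> except for \<open>f(x, x) = f(g x, x) = z\<close> and \<open>f(x, g x) = f(g x, g x) = - z\<close>.\<close>

definition sq_cocycle :: "('k::field, 'a::ab_group_add) hopf \<Rightarrow> 'a \<Rightarrow> 'k ^ h4 \<Rightarrow> 'k ^ h4 \<Rightarrow> 'a"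
  where "sq_cocycle A z h h' = hscale A (hcounit H4 h * hcounit H4 h') (hone A) +
    hscale A ((h $ Bx + h $ Bgx) * (h' $ Bx - h' $ Bgx)) z"

definition h4_ext :: "('k::field, 'a::ab_group_add) hopf \<Rightarrow> 'a \<Rightarrow> ('k, 'a ^ h4) hopf"
  where "h4_ext A z = crossed_product A H4 (triv_act A) (sq_cocycle A z)"

context hopf_algebra
begin

lemma h4_ext_sel [simp]:
  "hscale (h4_ext A z) = vscale A"
  "hone (h4_ext A z) = axis B1 (hone A)"
  "hcounit (h4_ext A z) v = hcounit A (v $ B1) + hcounit A (v $ Bg)"
  unfolding h4_ext_def by simp_all

lemma cp_mult_pure_sq_cocycle:
  "cp_mult_pure A H4 (triv_act A) (sq_cocycle A z) a (h4e i) c (h4e j) =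
    (case (i, j) of (Bx, Bx) \<Rightarrow> axis B1 (hmult A (hmult A a c) z)
      | (Bx, Bgx) \<Rightarrow> - axis Bg (hmult A (hmult A a c) z)
      | (Bgx, Bx) \<Rightarrow> axis Bg (hmult A (hmult A a c) z)
      | (Bgx, Bgx) \<Rightarrow> - axis B1 (hmult A (hmult A a c) z)
      | _ \<Rightarrow> 0) + cten A (hmult A a c) (h4_mult i j)"
  by (cases i; cases j)
    (simp_all add: cp_mult_pure_def sw3_def sw2_H4[OF is_vs_vscale] triv_act_def sq_cocycle_def
      H4_sel UNIV_h4 vec_eq_iff all_h4)

text \<open>Multiplication in the algebra generated over \<open>A\<close> by \<open>g\<close> and \<open>x\<close>, which commute with \<open>A\<close>: for
  instance \<open>(g x)\<^sup>2 = g x g x = - x\<^sup>2 = - z\<close>.\<close>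

lemma h4_ext_mult:
  "hmult (h4_ext A z) v w = (\<chi> i. case i of
      B1 \<Rightarrow> hmult A (v $ B1) (w $ B1) + hmult A (v $ Bg) (w $ Bg) +
        hmult A (hmult A (v $ Bx) (w $ Bx)) z - hmult A (hmult A (v $ Bgx) (w $ Bgx)) z
    | Bg \<Rightarrow> hmult A (v $ B1) (w $ Bg) + hmult A (v $ Bg) (w $ B1) +
        hmult A (hmult A (v $ Bgx) (w $ Bx)) z - hmult A (hmult A (v $ Bx) (w $ Bgx)) z
    | Bx \<Rightarrow> hmult A (v $ B1) (w $ Bx) + hmult A (v $ Bx) (w $ B1) +
        hmult A (v $ Bg) (w $ Bgx) - hmult A (v $ Bgx) (w $ Bg)
    | Bgx \<Rightarrow> hmult A (v $ B1) (w $ Bgx) + hmult A (v $ Bgx) (w $ B1) +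
        hmult A (v $ Bg) (w $ Bx) - hmult A (v $ Bx) (w $ Bg))"
  by (simp add: h4_ext_def crossed_product_def cp_mult_pure_sq_cocycle UNIV_h4 vec_eq_iff all_h4)

lemma sw2_h4_ext:
  assumes "vector_space t"
  shows "sw2 t (h4_ext A z) \<phi> v =
    sw2 t A (\<lambda>a b. \<phi> (axis B1 a) (axis B1 b)) (v $ B1) +
    sw2 t A (\<lambda>a b. \<phi> (axis Bg a) (axis Bg b)) (v $ Bg) +
    (sw2 t A (\<lambda>a b. \<phi> (axis Bx a) (axis B1 b)) (v $ Bx) +
     sw2 t A (\<lambda>a b. \<phi> (axis Bg a) (axis Bx b)) (v $ Bx)) +
    (sw2 t A (\<lambda>a b. \<phi> (axis Bgx a) (axis Bg b)) (v $ Bgx) +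
     sw2 t A (\<lambda>a b. \<phi> (axis B1 a) (axis Bgx b)) (v $ Bgx))"
  unfolding h4_ext_def by (rule sw2_crossed_product[OF assms])

lemma bilinear_axis:
  "bilinear_map (vscale A) (vscale A) t \<phi> \<Longrightarrow>
    bilinear_map (hscale A) (hscale A) t (\<lambda>a b. \<phi> (axis i a) (axis j b))"
  by (rule bilinear_comp[OF _ linear_axis linear_axis])

text \<open>\<open>\<Delta>(c z) = \<Delta>(c) (z \<otimes> 1 + 1 \<otimes> z)\<close>.\<close>

lemma sw2_mult_primitive:
  assumes bil: "bilinear_map (hscale A) (hscale A) t \<phi>" and z: "z \<in> primitives A"
  shows "sw2 t A \<phi> (hmult A c z) = sw2 t A (\<lambda>a b. \<phi> (hmult A a z) b + \<phi> a (hmult A b z)) c"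
proof -
  have "sw2 t A (\<lambda>b1 b2. \<phi> (hmult A a1 b1) (hmult A a2 b2)) z =
      \<phi> (hmult A a1 z) a2 + \<phi> a1 (hmult A a2 z)" for a1 a2
    by (subst sw2_primitive[OF _ z]) (use bil in \<open>simp_all add: bilinear_map_iff\<close>)
  then show ?thesis
    by (simp add: sw2_mult[OF bil])
qed

text \<open>The relation to be checked is \<open>x\<^sup>2 = z\<close>.  In
  \<open>\<Delta>(x)\<^sup>2 = x\<^sup>2 \<otimes> 1 + x g \<otimes> x + g x \<otimes> x + g\<^sup>2 \<otimes> x\<^sup>2\<close> the middle terms cancel and \<open>z \<otimes> 1 + 1 \<otimes> z\<close> is left,
  which is \<open>\<Delta>(z)\<close> because \<open>z\<close> is primitive.\<close>

lemma sw2_h4_ext_mult: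
  fixes z :: 'a
  assumes z: "z \<in> ZP A" and bil: "bilinear_map (vscale A) (vscale A) t \<phi>"
  defines "E \<equiv> h4_ext A z"
  shows "sw2 t E \<phi> (hmult E v w) =
    sw2 t E (\<lambda>v1 v2. sw2 t E (\<lambda>w1 w2. \<phi> (hmult E v1 w1) (hmult E v2 w2)) w) v"
proof -
  note T = bilinear_vector_space[OF bil]
  interpret T: vector_space t by fact
  have zc: "hmult A z a = hmult A a z" for a
    using z by (simp add: ZP_def center_def)
  have zp: "z \<in> primitives A"
    using z by (simp add: ZP_def)
  have axis: "hmult E (axis B1 a) (axis j b) = axis j (hmult A a b)"
    "hmult E (axis Bg a) (axis B1 b) = axis Bg (hmult A a b)"
    "hmult E (axis Bg a) (axis Bg b) = axis B1 (hmult A a b)"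
    "hmult E (axis Bg a) (axis Bx b) = axis Bgx (hmult A a b)"
    "hmult E (axis Bg a) (axis Bgx b) = axis Bx (hmult A a b)"
    "hmult E (axis Bx a) (axis B1 b) = axis Bx (hmult A a b)"
    "hmult E (axis Bx a) (axis Bg b) = - axis Bgx (hmult A a b)"
    "hmult E (axis Bx a) (axis Bx b) = axis B1 (hmult A a (hmult A b z))"
    "hmult E (axis Bx a) (axis Bgx b) = - axis Bg (hmult A a (hmult A b z))"
    "hmult E (axis Bgx a) (axis B1 b) = axis Bgx (hmult A a b)"
    "hmult E (axis Bgx a) (axis Bg b) = - axis Bx (hmult A a b)"
    "hmult E (axis Bgx a) (axis Bx b) = axis Bg (hmult A a (hmult A b z))"
    "hmult E (axis Bgx a) (axis Bgx b) = - axis B1 (hmult A a (hmult A b z))" for a b j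
    by (cases j; simp add: E_def h4_ext_mult mult_assoc vec_eq_iff all_h4)+
  have \<phi>: "\<phi> (- u) v = - \<phi> u v" "\<phi> u (- v) = - \<phi> u v" for u v
  proof -
    interpret l: Vector_Spaces.linear "vscale A" t "\<phi> u"
      using bil by (simp add: bilinear_map_def)
    interpret r: Vector_Spaces.linear "vscale A" t "\<lambda>u. \<phi> u v"
      using bil by (simp add: bilinear_map_def)
    show "\<phi> (- u) v = - \<phi> u v" "\<phi> u (- v) = - \<phi> u v"
      by (rule l.neg r.neg)+
  qed
  have b1: "bilinear_map (hscale A) (hscale A) t (\<lambda>a b. \<phi> (axis i a) (axis j b))" for i j
    by (rule bilinear_axis[OF bil])
  have b2: "bilinear_map (hscale A) (hscale A) t
      (\<lambda>a b. \<phi> (axis i (hmult A c a)) (axis j (hmult A d b)))" for i j c d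
    using b1 by (simp add: bilinear_map_iff)
  note sw = sw2_linear(1,3,4)[OF b1] sw2_mult[OF b1] sw2_mult_primitive[OF b2 zp]
  have diff: "sw2 t A (\<lambda>a b. \<phi> (axis i a) (axis j b)) (c - d) =
    sw2 t A (\<lambda>a b. \<phi> (axis i a) (axis j b)) c - sw2 t A (\<lambda>a b. \<phi> (axis i a) (axis j b)) d" for i j c d
    using sw(1)[of i j c "- d"] sw(2) by simp
  show ?thesis
    unfolding E_def sw2_h4_ext[OF T]
    unfolding E_def[symmetric]
    by (simp add: axis \<phi> sw2_fun_linear[OF T], simp add: E_def h4_ext_mult sw diff mult_assoc zc)
      (simp add: sw2_fun_linear[OF T] algebra_simps)
qed

text \<open>Associativity holds because \<open>z\<close> is central, multiplicativity of \<open>\<Delta>\<close> because \<open>z\<close> is primitive.\<close>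

theorem hopf_algebra_h4_ext:
  assumes z: "z \<in> ZP A"
  shows "hopf_algebra (h4_ext A z)"
proof (rule hopf_algebraI_forms; (simp only: h4_ext_sel)?)
  note K = vector_space_scalars[where 'k = 'k]
  let ?E = "h4_ext A z"
  have zc: "hmult A z a = hmult A a z" for a
    using z by (simp add: ZP_def center_def)
  have ez: "hcounit A z = 0"
    using z by (simp add: ZP_def counit_primitive)
  show "vector_space (vscale A :: 'k \<Rightarrow> 'a ^ h4 \<Rightarrow> _)" by simp
  show "bilinear_map (vscale A) (vscale A) (vscale A) (hmult ?E)"
    by (simp add: bilinear_map_iff h4_ext_mult vec_eq_iff all_h4 algebra_simps
      V.scale_right_distrib V.scale_right_diff_distrib)
  show "Vector_Spaces.linear (vscale A) (*) (hcounit ?E)"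
    by (simp add: Vector_Spaces.linear_iff K algebra_simps)
  show "hcounit A (axis B1 (hone A) $ B1) + hcounit A (axis B1 (hone A) $ Bg) = 1"
    by simp
  fix u v w :: "'a ^ h4"
  show "hmult ?E (hmult ?E u v) w = hmult ?E u (hmult ?E v w)"
    by (simp add: h4_ext_mult vec_eq_iff all_h4 mult_assoc zc)
  show "hmult ?E (axis B1 (hone A)) v = v" "hmult ?E v (axis B1 (hone A)) = v"
    by (simp_all add: h4_ext_mult vec_eq_iff all_h4)
  show "hcounit A (hmult ?E v w $ B1) + hcounit A (hmult ?E v w $ Bg) =
      (hcounit A (v $ B1) + hcounit A (v $ Bg)) * (hcounit A (w $ B1) + hcounit A (w $ Bg))"
    by (simp add: h4_ext_mult ez algebra_simps)
  have axis_counit: "sw2 (vscale A) A (\<lambda>a b. axis i (hscale A (hcounit A a) b)) c = axis i c"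
    "sw2 (vscale A) A (\<lambda>a b. axis i (hscale A (hcounit A b) a)) c = axis i c" for i c
    using sw2_counit[OF linear_axis] by simp_all
  show "sw2 (vscale A) ?E (\<lambda>v1 v2. vscale A (hcounit A (v1 $ B1) + hcounit A (v1 $ Bg)) v2) v = v"
    "sw2 (vscale A) ?E (\<lambda>v1 v2. vscale A (hcounit A (v2 $ B1) + hcounit A (v2 $ Bg)) v1) v = v"
    using vec_h4_expand[of v]
    by (simp_all add: sw2_h4_ext axis_counit sw2_fun_linear)
  show "\<exists>S. is_antipode ?E S"
  proof -
    let ?S = "antipode A"
    note S = is_antipode_antipode[unfolded is_antipode_def]
    have Sl: "?S (a + b) = ?S a + ?S b" "?S (hscale A c a) = hscale A c (?S a)" "?S 0 = 0" for a b c
    proof -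
      interpret Vector_Spaces.linear "hscale A" "hscale A" ?S using S by blast
      show "?S (a + b) = ?S a + ?S b" "?S (hscale A c a) = hscale A c (?S a)" "?S 0 = 0"
        by (rule add scale zero)+
    qed
    \<comment> \<open>As in \<open>H\<^sub>4\<close>, the antipode has \<open>S(x) = - g x\<close> and \<open>S(g x) = x\<close>; elements of \<open>A\<close> commute with both.\<close>
    define T where "T v = (\<chi> i. case i of B1 \<Rightarrow> ?S (v $ B1) | Bg \<Rightarrow> ?S (v $ Bg) | Bx \<Rightarrow> ?S (v $ Bgx) | Bgx \<Rightarrow> - ?S (v $ Bx))" for v :: "'a ^ h4"
    have conv: "sw2 (vscale A) A (\<lambda>a b. axis i (hmult A (?S a) b)) c = axis i (hscale A (hcounit A c) (hone A))"
      "sw2 (vscale A) A (\<lambda>a b. axis i (hmult A a (?S b))) c = axis i (hscale A (hcounit A c) (hone A))" for i c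
      using S by (simp_all add: linear_image_sw2[OF linear_axis, symmetric])
    have mult: "hmult ?E (T (axis B1 a)) (axis B1 b) = axis B1 (hmult A (?S a) b)"
      "hmult ?E (T (axis Bg a)) (axis Bg b) = axis B1 (hmult A (?S a) b)"
      "hmult ?E (T (axis Bx a)) (axis B1 b) = - axis Bgx (hmult A (?S a) b)"
      "hmult ?E (T (axis Bg a)) (axis Bx b) = axis Bgx (hmult A (?S a) b)"
      "hmult ?E (T (axis Bgx a)) (axis Bg b) = - axis Bgx (hmult A (?S a) b)"
      "hmult ?E (T (axis B1 a)) (axis Bgx b) = axis Bgx (hmult A (?S a) b)"
      "hmult ?E (axis B1 a) (T (axis B1 b)) = axis B1 (hmult A a (?S b))"
      "hmult ?E (axis Bg a) (T (axis Bg b)) = axis B1 (hmult A a (?S b))"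
      "hmult ?E (axis Bx a) (T (axis B1 b)) = axis Bx (hmult A a (?S b))"
      "hmult ?E (axis Bg a) (T (axis Bx b)) = - axis Bx (hmult A a (?S b))"
      "hmult ?E (axis Bgx a) (T (axis Bg b)) = - axis Bx (hmult A a (?S b))"
      "hmult ?E (axis B1 a) (T (axis Bgx b)) = axis Bx (hmult A a (?S b))" for a b
      by (simp_all add: h4_ext_mult vec_eq_iff all_h4 Sl T_def)
    have T_linear: "Vector_Spaces.linear (vscale A) (vscale A) T"
      by (simp add: Vector_Spaces.linear_iff vec_eq_iff all_h4 Sl T_def)
    have "is_antipode ?E T"
      using T_linear unfolding is_antipode_def
      by (simp add: sw2_h4_ext mult conv sw2_fun_linear vec_eq_iff all_h4 V.scale_left_distrib)
    then show "\<exists>S. is_antipode ?E S" by blast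
  qed
next
  let ?E = "h4_ext A z"
  note K = vector_space_scalars[where 'k = 'k]
  fix \<phi> :: "'a ^ h4 \<Rightarrow> 'a ^ h4 \<Rightarrow> 'k"
  assume bil: "bilinear_map (vscale A) (vscale A) (*) \<phi>"
  note b = bilinear_axis[OF bil]
  show "Vector_Spaces.linear (vscale A) (*) (sw2 (*) ?E \<phi>)"
    by (simp add: Vector_Spaces.linear_iff K sw2_h4_ext sw2_linear[OF b] algebra_simps)
  show "sw2 (*) ?E \<phi> (axis B1 (hone A)) = \<phi> (axis B1 (hone A)) (axis B1 (hone A))"
    by (simp add: K sw2_h4_ext sw2_linear[OF b] sw2_one[OF b])
  show "sw2 (*) ?E \<phi> (hmult ?E v w) =
      sw2 (*) ?E (\<lambda>v1 v2. sw2 (*) ?E (\<lambda>w1 w2. \<phi> (hmult ?E v1 w1) (hmult ?E v2 w2)) w) v" for v w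
    by (rule sw2_h4_ext_mult[OF z bil])
next
  let ?E = "h4_ext A z"
  note K = vector_space_scalars[where 'k = 'k]
  fix \<phi> :: "'a ^ h4 \<Rightarrow> 'a ^ h4 \<Rightarrow> 'a ^ h4 \<Rightarrow> 'k" and v
  assume tri: "trilinear_map (vscale A) (*) \<phi>"
  have b: "bilinear_map (hscale A) (hscale A) (*) (\<lambda>a b. \<phi> (axis i a) (axis j b) w)"
    "bilinear_map (hscale A) (hscale A) (*) (\<lambda>a b. \<phi> w (axis i a) (axis j b))" for i j w
    using tri by (intro bilinear_axis; simp add: trilinear_map_def)+
  have t: "trilinear_map (hscale A) (*) (\<lambda>a b c. \<phi> (axis i a) (axis j b) (axis k c))" for i j k
    unfolding trilinear_map_def using b by simp
  show "sw2 (*) ?E (\<lambda>v v3. sw2 (*) ?E (\<lambda>v1 v2. \<phi> v1 v2 v3) v) v =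
      sw2 (*) ?E (\<lambda>v1 v. sw2 (*) ?E (\<phi> v1) v) v"
    by (simp add: K sw2_h4_ext sw2_linear[OF b(1)] sw2_linear[OF b(2)] sw2_fun_linear sw2_coassoc[OF t])
qed

lemma weak_action_triv: "weak_action H4 A (triv_act A)"
proof -
  interpret H: hopf_algebra "H4 :: ('k, 'k ^ h4) hopf" by (rule hopf_algebra_H4)
  have H: "vector_space ((*s) :: 'k \<Rightarrow> 'k ^ h4 \<Rightarrow> 'k ^ h4)"
    using H.is_vs by (simp add: H4_sel)
  have s: "hcounit H4 (c *s h) = c * hcounit H4 h" for c and h :: "'k ^ h4"
    using H.counit_lin(2) by (simp add: H4_sel(1))
  show ?thesis
    unfolding weak_action_def
    by (simp add: bilinear_map_iff triv_act_def H s sw2_H4 H4_sel(1,2) V.scale_left_distrib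
      V.scale_right_distrib mult.commute) (simp add: H4_sel UNIV_h4 V.scale_left_distrib)
qed

lemma bilinear_sq_cocycle: "bilinear_map (hscale H4) (hscale H4) (hscale A) (sq_cocycle A z)"
proof -
  interpret H: hopf_algebra "H4 :: ('k, 'k ^ h4) hopf" by (rule hopf_algebra_H4)
  have H: "vector_space ((*s) :: 'k \<Rightarrow> 'k ^ h4 \<Rightarrow> 'k ^ h4)"
    using H.is_vs by (simp add: H4_sel)
  have s: "hcounit H4 (c *s h) = c * hcounit H4 h" for c and h :: "'k ^ h4"
    using H.counit_lin(2) by (simp add: H4_sel(1))
  have [simp]: "hscale H4 = (*s)" by (simp add: H4_sel)
  show ?thesis
    by (simp add: bilinear_map_iff H s sq_cocycle_def V.scale_right_distrib ring_distribs V.scale_left_distrib V.scale_left_diff_distrib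
      V.scale_right_diff_distrib mult.left_commute mult.assoc)
qed

lemma crossed_system_sq_cocycle:
  "z \<in> ZP A \<Longrightarrow> crossed_system A H4 (triv_act A) (sq_cocycle A z)"
  using hopf_algebra_h4_ext[of z]
  by (simp add: crossed_system_def weak_action_triv bilinear_sq_cocycle h4_ext_def)

end

section \<open>Classification of the crossed systems\<close>

lemma bilinear_zero:
  assumes "bilinear_map sA sB sC \<phi>"
  shows "\<phi> 0 b = 0" "\<phi> a 0 = 0"
proof -
  interpret l: Vector_Spaces.linear sB sC "\<phi> a"
    using assms by (simp add: bilinear_map_def)
  interpret r: Vector_Spaces.linear sA sC "\<lambda>a. \<phi> a b"
    using assms by (simp add: bilinear_map_def)
  show "\<phi> 0 b = 0" "\<phi> a 0 = 0"
    by (rule l.zero r.zero)+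
qed

lemma bilinear_basis_left:
  fixes h :: "'k::field ^ h4"
  assumes "bilinear_map (*s) sB sC \<phi>"
  shows "\<phi> h b = sC (h $ B1) (\<phi> (h4e B1) b) + sC (h $ Bg) (\<phi> (h4e Bg) b) +
    sC (h $ Bx) (\<phi> (h4e Bx) b) + sC (h $ Bgx) (\<phi> (h4e Bgx) b)"
proof -
  have "\<phi> h b = \<phi> (h $ B1 *s h4e B1 + h $ Bg *s h4e Bg + h $ Bx *s h4e Bx + h $ Bgx *s h4e Bgx) b"
    by (rule arg_cong[where f = "\<lambda>h. \<phi> h b"]) (simp add: vec_eq_iff all_h4)
  also have "\<dots> = sC (h $ B1) (\<phi> (h4e B1) b) + sC (h $ Bg) (\<phi> (h4e Bg) b) +
      sC (h $ Bx) (\<phi> (h4e Bx) b) + sC (h $ Bgx) (\<phi> (h4e Bgx) b)"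
    using assms by (simp only: bilinear_map_iff)
  finally show ?thesis .
qed

lemma bilinear_flip: "bilinear_map sA sB sC \<phi> \<Longrightarrow> bilinear_map sB sA sC (\<lambda>b a. \<phi> a b)"
  by (simp add: bilinear_map_iff)

lemma bilinear_eqI_basis_left:
  assumes "bilinear_map (*s) sB sC \<phi>" "bilinear_map (*s) sB sC \<psi>"
    and "\<And>i b. \<phi> (h4e i) b = \<psi> (h4e i) b"
  shows "\<phi> = \<psi>"
proof (intro ext)
  fix h b
  show "\<phi> h b = \<psi> h b"
    using bilinear_basis_left[OF assms(1), of h b] bilinear_basis_left[OF assms(2), of h b]
    by (simp only: assms(3))
qed

lemma bilinear_eqI_basis:
  assumes "bilinear_map (*s) (*s) sC \<phi>" "bilinear_map (*s) (*s) sC \<psi>"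
    and "\<And>i j. \<phi> (h4e i) (h4e j) = \<psi> (h4e i) (h4e j)"
  shows "\<phi> = \<psi>"
proof (rule bilinear_eqI_basis_left[OF assms(1,2)])
  fix i b
  show "\<phi> (h4e i) b = \<psi> (h4e i) b"
    using bilinear_basis_left[OF bilinear_flip[OF assms(1)], where h = b and b = "h4e i"]
      bilinear_basis_left[OF bilinear_flip[OF assms(2)], where h = b and b = "h4e i"]
    by (simp only: assms(3))
qed

context hopf_algebra
begin

lemma bilinear_sw2_mult:
  assumes "bilinear_map (hscale A) (hscale A) t \<phi>"
  shows "bilinear_map (hscale A) (hscale A) t
    (\<lambda>a1 a2. sw2 t A (\<lambda>b1 b2. \<phi> (hmult A a1 b1) (hmult A a2 b2)) b)"
proof -
  note T = bilinear_vector_space[OF assms]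
  show ?thesis
    using assms by (simp add: bilinear_map_iff sw2_fun_linear[OF T])
qed

text \<open>To compare the coefficients of two elements of \<open>(A \<otimes> H\<^sub>4) \<otimes> (A \<otimes> H\<^sub>4)\<close> at \<open>e\<^sub>i\<close> in the first and at
  \<open>e\<^sub>j\<close> in the second copy of \<open>H\<^sub>4\<close>, it is enough for what follows to apply \<open>\<epsilon>\<close> to the first copy of \<open>A\<close>.\<close>

definition comp_form :: "h4 \<Rightarrow> h4 \<Rightarrow> 'a ^ h4 \<Rightarrow> 'a ^ h4 \<Rightarrow> 'a"
  where "comp_form i j v w = hscale A (hcounit A (v $ i)) (w $ j)"

lemma bilinear_comp_form: "bilinear_map (vscale A) (vscale A) (hscale A) (comp_form i j)"
  by (simp add: bilinear_map_iff comp_form_def V.scale_left_distrib V.scale_right_distrib mult.commute)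

lemma sw2_counit_id [simp]:
  "sw2 (hscale A) A (\<lambda>a b. hscale A (hcounit A a) b) c = c"
  "sw2 (hscale A) A (\<lambda>a b. hscale A (hcounit A b) a) c = c"
  by (rule counit_left counit_right)+

text \<open>Only the six pairs of basis elements that occur in \<open>\<Delta>\<close> on \<open>H\<^sub>4\<close> give non-zero coefficients; the
  vanishing of the others is what forces elements of \<open>A\<close> to be zero below.\<close>

lemma sw2_comp_form:
  "sw2 (hscale A) (crossed_product A H4 act f) (comp_form i j) v =
    (case (i, j) of (B1, B1) \<Rightarrow> v $ B1 | (Bg, Bg) \<Rightarrow> v $ Bg | (Bx, B1) \<Rightarrow> v $ Bx | (Bg, Bx) \<Rightarrow> v $ Bx
      | (Bgx, Bg) \<Rightarrow> v $ Bgx | (B1, Bgx) \<Rightarrow> v $ Bgx | _ \<Rightarrow> 0)"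
  by (cases i; cases j; simp add: sw2_crossed_product comp_form_def sw2_fun_zero)

lemma sw2_crossed_basis:
  assumes "bilinear_map (vscale A) (vscale A) t \<phi>"
  shows "sw2 t (crossed_product A H4 act f) \<phi> (axis B1 a) = sw2 t A (\<lambda>a b. \<phi> (axis B1 a) (axis B1 b)) a"
    and "sw2 t (crossed_product A H4 act f) \<phi> (axis Bg (hone A)) = \<phi> (axis Bg (hone A)) (axis Bg (hone A))"
    and "sw2 t (crossed_product A H4 act f) \<phi> (axis Bx (hone A)) =
      \<phi> (axis Bx (hone A)) (axis B1 (hone A)) + \<phi> (axis Bg (hone A)) (axis Bx (hone A))"
    and "sw2 t (crossed_product A H4 act f) \<phi> (axis Bgx (hone A)) =
      \<phi> (axis Bgx (hone A)) (axis Bg (hone A)) + \<phi> (axis B1 (hone A)) (axis Bgx (hone A))"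
  using bilinear_vector_space[OF assms]
  by (simp_all add: sw2_crossed_product sw2_linear[OF bilinear_axis[OF assms]] sw2_one[OF bilinear_axis[OF assms]])

lemma crossed_product_mult_axis:
  assumes act: "bilinear_map (hscale H4) (hscale A) (hscale A) act"
  shows "hmult (crossed_product A H4 act f) (axis i a) (axis j c) =
    cp_mult_pure A H4 act f a (h4e i) c (h4e j)"
proof -
  have "cp_mult_pure A H4 act f 0 h c g = 0" "cp_mult_pure A H4 act f a h 0 g = 0" for a c h g
    by (simp_all add: cp_mult_pure_def bilinear_zero[OF act] bilinear_zero[OF bilinear_cten[OF is_vs]] sw3_def sw2_fun_zero)
  then show ?thesis
    by (cases i; cases j) (simp_all add: crossed_product_def UNIV_h4)
qed

lemmas pure_simps = cp_mult_pure_def sw3_def sw2_H4[OF is_vs_vscale] H4_sel UNIV_h4 vec_eq_iff all_h4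

text \<open>The unit laws normalise \<open>f\<close>, and then \<open>x c = (x \<triangleright> c) # 1 + (g \<triangleright> c) # x\<close> for \<open>c \<in> A\<close>.  In
  \<open>\<Delta>(x c) = \<Delta>(x) \<Delta>(c)\<close> the coefficients at \<open>x \<otimes> 1\<close> give \<open>g \<triangleright> c = c\<close>, those at \<open>g \<otimes> 1\<close> give \<open>x \<triangleright> c = 0\<close>;
  the coefficients at \<open>1 \<otimes> g\<close> for \<open>g x\<close> in place of \<open>x\<close> give \<open>(g x) \<triangleright> c = 0\<close>.\<close>

lemma crossed_system_triv_normalized:
  assumes "crossed_system A H4 act f"
  shows "act = triv_act A" and "f (h4e B1) h = hscale A (hcounit H4 h) (hone A)"
    "f h (h4e B1) = hscale A (hcounit H4 h) (hone A)"
proof -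
  let ?P = "crossed_product A H4 act f"
  have bact: "bilinear_map (*s) (hscale A) (hscale A) act"
    and wact: "weak_action H4 A act" and bf: "bilinear_map (*s) (*s) (hscale A) f"
    using assms by (simp_all add: crossed_system_def weak_action_def H4_sel)
  interpret P: hopf_algebra ?P
    using assms by (simp add: crossed_system_def)
  note mult_axis = crossed_product_mult_axis[OF bact[folded H4_sel(1)]]
  have act1 [simp]: "act (h4e B1) a = a" and act_one [simp]: "act h (hone A) = hscale A (hcounit H4 h) (hone A)" for a h
    using wact by (simp_all add: weak_action_def H4_sel(2))
  have [simp]: "hcounit H4 (h4e i) = h4_counit i" for i
    by (cases i) (simp_all add: H4_sel UNIV_h4)
  have un: "hmult ?P (axis i (hone A)) (axis B1 (hone A)) = axis i (hone A)"
    "hmult ?P (axis B1 (hone A)) (axis i (hone A)) = axis i (hone A)" for i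
    using P.mult_one_right P.mult_one_left by simp_all
  have f1 [simp]: "f (h4e i) (h4e B1) = hscale A (h4_counit i) (hone A)"
     "f (h4e B1) (h4e i) = hscale A (h4_counit i) (hone A)" for i
    using un(1)[of B1] un(1)[of Bg] un(1)[of Bx] un(1)[of Bgx]
      un(2)[of B1] un(2)[of Bg] un(2)[of Bx] un(2)[of Bgx]
    unfolding mult_axis by (cases i; simp add: pure_simps)+
  show "f h (h4e B1) = hscale A (hcounit H4 h) (hone A)" "f (h4e B1) h = hscale A (hcounit H4 h) (hone A)" for h
    using bilinear_basis_left[OF bf, of h "h4e B1"] bilinear_basis_left[OF bilinear_flip[OF bf], where h = h and b = "h4e B1"]
    by (simp_all add: H4_sel(5) UNIV_h4 V.scale_left_distrib)
  have m: "hmult ?P (axis Bg (hone A)) (axis B1 c) = axis Bg (act (h4e Bg) c)"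
    "hmult ?P (axis Bx (hone A)) (axis B1 c) = axis B1 (act (h4e Bx) c) + axis Bx (act (h4e Bg) c)"
    "hmult ?P (axis Bgx (hone A)) (axis B1 c) = axis Bg (act (h4e Bgx) c) + axis Bgx c" for c
    unfolding mult_axis by (simp_all add: pure_simps)
  have ceps: "hcounit A (act (h4e Bg) c) = hcounit A c" for c
    using P.counit_mult[of "axis Bg (hone A)" "axis B1 c"] by (simp add: m)
  have Q: "bilinear_map (vscale A) (vscale A) (hscale A)
      (\<lambda>v1 v2. sw2 (hscale A) ?P (\<lambda>w1 w2. comp_form i j (hmult ?P v1 w1) (hmult ?P v2 w2)) w)" for i j w
    using P.bilinear_sw2_mult[of "hscale A" "comp_form i j"] bilinear_comp_form by simp
  have bi: "bilinear_map (vscale A) (vscale A) (hscale A) (\<lambda>w1 w2. comp_form i j (hmult ?P v1 w1) (hmult ?P v2 w2))"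
    for i j v1 v2
    by (simp add: bilinear_map_iff comp_form_def P.mult_linear[unfolded crossed_product_sel(1)]
      V.scale_left_distrib V.scale_right_distrib mult.commute)
  have cm: "sw2 (hscale A) ?P (comp_form i j) (hmult ?P v w) =
     sw2 (hscale A) ?P (\<lambda>v1 v2. sw2 (hscale A) ?P (\<lambda>w1 w2. comp_form i j (hmult ?P v1 w1) (hmult ?P v2 w2)) w) v" for i j v w
    using P.sw2_mult[of "hscale A" "comp_form i j"] bilinear_comp_form by simp
  have ex: "sw2 (hscale A) ?P (comp_form i j) (hmult ?P (axis Bx (hone A)) (axis B1 c)) =
      sw2 (hscale A) A (\<lambda>a b. comp_form i j (hmult ?P (axis Bx (hone A)) (axis B1 a))
        (hmult ?P (axis B1 (hone A)) (axis B1 b))) c +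
      sw2 (hscale A) A (\<lambda>a b. comp_form i j (hmult ?P (axis Bg (hone A)) (axis B1 a))
        (hmult ?P (axis Bx (hone A)) (axis B1 b))) c"
    "sw2 (hscale A) ?P (comp_form i j) (hmult ?P (axis Bgx (hone A)) (axis B1 c)) =
      sw2 (hscale A) A (\<lambda>a b. comp_form i j (hmult ?P (axis Bgx (hone A)) (axis B1 a))
        (hmult ?P (axis Bg (hone A)) (axis B1 b))) c +
      sw2 (hscale A) A (\<lambda>a b. comp_form i j (hmult ?P (axis B1 (hone A)) (axis B1 a))
        (hmult ?P (axis Bgx (hone A)) (axis B1 b))) c" for i j c
    unfolding cm unfolding sw2_crossed_basis[OF Q] unfolding sw2_crossed_basis(1)[OF bi] by simp_all
  have lin: "Vector_Spaces.linear (hscale A) (hscale A) (act h)" for h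
    using bact by (simp add: bilinear_map_def)
  have one_l: "hmult ?P (axis B1 (hone A)) v = v" for v
    using P.mult_one_left[of v] by simp
  have gg: "act (h4e Bg) c = c" for c
    using ex(1)[of Bx B1 c] unfolding m one_l
    by (simp add: sw2_comp_form comp_form_def ceps sw2_fun_zero)
  have xx: "act (h4e Bx) c = 0" for c
    using ex(1)[of Bg B1 c] unfolding m one_l
    by (simp add: sw2_comp_form comp_form_def ceps sw2_fun_zero sw2_counit[OF lin])
  have yy: "act (h4e Bgx) c = 0" for c
    using ex(2)[of B1 Bg c] unfolding m one_l
    by (simp add: sw2_comp_form comp_form_def ceps sw2_fun_zero sw2_counit[OF lin])
  show "act = triv_act A"
  proof (rule bilinear_eqI_basis_left[OF bact])
    show "bilinear_map (*s) (hscale A) (hscale A) (triv_act A)"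
      using weak_action_triv by (simp add: weak_action_def H4_sel(1))
    show "act (h4e i) b = triv_act A (h4e i) b" for i b
      by (cases i) (simp_all add: triv_act_def gg xx yy)
  qed
qed

text \<open>Once \<open>g\<^sup>2 = 1\<close>, \<open>x g = - g x\<close> and \<open>x\<^sup>2 = z \<in> A\<close> are known in the crossed product, and the product of
  \<open>g\<close> and \<open>x\<close> is the basis element, associativity determines all products of basis elements, and
  \<open>f(h, h')\<close> is recovered from \<open>(1 # h) (1 # h')\<close> by applying \<open>\<epsilon>\<close> of \<open>H\<^sub>4\<close>.\<close>

theorem crossed_system_classification:
  assumes "crossed_system A H4 act f"
  shows "\<exists>z\<in>ZP A. act = triv_act A \<and> f = sq_cocycle A z"
proof -
  note triv = crossed_system_triv_normalized[OF assms]
  have cs: "crossed_system A H4 (triv_act A) f"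
    using assms by (simp only: triv(1))
  let ?P = "crossed_product A H4 (triv_act A) f"
  define X where "X = axis Bx (hone A)"
  define G where "G = axis Bg (hone A)"
  define Y where "Y = axis Bgx (hone A)"
  define z where "z = f (h4e Bx) (h4e Bx)"
  have bact: "bilinear_map (*s) (hscale A) (hscale A) (triv_act A)"
    and bf: "bilinear_map (*s) (*s) (hscale A) f"
    using cs by (simp_all add: crossed_system_def weak_action_def H4_sel)
  interpret P: hopf_algebra ?P
    using cs by (simp add: crossed_system_def)
  note mult_axis = crossed_product_mult_axis[OF bact[folded H4_sel(1)]]
  have [simp]: "hcounit H4 (h4e i) = h4_counit i" for i
    by (cases i) (simp_all add: H4_sel UNIV_h4)
  note f1 = triv(2,3)
  note ps = f1 pure_simps triv_act_def
  have one: "hmult ?P (axis B1 (hone A)) v = v" "hmult ?P v (axis B1 (hone A)) = v" for v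
    using P.mult_one_left[of v] P.mult_one_right[of v] by simp_all
  have \<iota>: "hmult ?P (axis B1 a) (axis i c) = axis i (hmult A a c)" for a i c
    unfolding mult_axis by (cases i; simp add: ps)
  have \<iota>': "hmult ?P (axis i a) (axis B1 c) = axis i (hmult A a c)" for a i c
    unfolding mult_axis by (cases i; simp add: ps)
  have m: "hmult ?P G G = axis B1 (f (h4e Bg) (h4e Bg))"
    "hmult ?P G X = axis Bg (f (h4e Bg) (h4e Bx)) + axis Bgx (f (h4e Bg) (h4e Bg))"
    "hmult ?P X G = axis Bg (f (h4e Bx) (h4e Bg)) - axis Bgx (f (h4e Bg) (h4e Bg))"
    "hmult ?P X X = axis B1 z + axis Bx (f (h4e Bx) (h4e Bg) + f (h4e Bg) (h4e Bx))"
    unfolding mult_axis X_def G_def z_def by (simp_all add: ps)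
  have f_val: "f (h4e i) (h4e j) = hmult ?P (axis i (hone A)) (axis j (hone A)) $ B1 +
      hmult ?P (axis i (hone A)) (axis j (hone A)) $ Bg" for i j
    unfolding mult_axis by (cases i; cases j; simp add: ps)
  have Q: "bilinear_map (vscale A) (vscale A) t
      (\<lambda>v1 v2. sw2 t ?P (\<lambda>w1 w2. \<phi> (hmult ?P v1 w1) (hmult ?P v2 w2)) w)"
    if "bilinear_map (vscale A) (vscale A) t \<phi>" for \<phi> t w
    using P.bilinear_sw2_mult[of t \<phi>] that by simp
  have bi: "bilinear_map (vscale A) (vscale A) t (\<lambda>w1 w2. \<phi> (hmult ?P v1 w1) (hmult ?P v2 w2))"
    if "bilinear_map (vscale A) (vscale A) t \<phi>" for \<phi> t v1 v2
    using that by (simp add: bilinear_map_iff P.mult_linear[unfolded crossed_product_sel(1)])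
  have cm: "sw2 t ?P \<phi> (hmult ?P v w) =
     sw2 t ?P (\<lambda>v1 v2. sw2 t ?P (\<lambda>w1 w2. \<phi> (hmult ?P v1 w1) (hmult ?P v2 w2)) w) v"
    if "bilinear_map (vscale A) (vscale A) t \<phi>" for \<phi> t v w
    using P.sw2_mult[of t \<phi>] that by simp
  have ex: "sw2 t ?P \<phi> (hmult ?P G G) = \<phi> (hmult ?P G G) (hmult ?P G G)"
    "sw2 t ?P \<phi> (hmult ?P G X) = \<phi> (hmult ?P G X) G + \<phi> (hmult ?P G G) (hmult ?P G X)"
    "sw2 t ?P \<phi> (hmult ?P X G) = \<phi> (hmult ?P X G) G + \<phi> (hmult ?P G G) (hmult ?P X G)"
    "sw2 t ?P \<phi> (hmult ?P X X) = \<phi> (hmult ?P X X) (axis B1 (hone A)) + \<phi> (hmult ?P X G) X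
       + \<phi> (hmult ?P G X) X + \<phi> (hmult ?P G G) (hmult ?P X X)"
    if "bilinear_map (vscale A) (vscale A) t \<phi>" for t \<phi>
    unfolding cm[OF that] X_def G_def
    unfolding sw2_crossed_basis[OF Q[OF that]]
    unfolding sw2_crossed_basis[OF bi[OF that]]
    by (simp_all only: one ac_simps)
  have eg: "hcounit A (f (h4e Bg) (h4e Bg)) = 1"
    using P.counit_mult[of G G] unfolding m(1) by (simp add: G_def)
  note sc = sw2_comp_form comp_form_def
  \<comment> \<open>Coefficients of \<open>\<Delta>(g x)\<close> at \<open>g x \<otimes> g\<close> and \<open>1 \<otimes> g\<close>, and of \<open>\<Delta>(x g)\<close> at \<open>1 \<otimes> g\<close>; no element of
    \<open>A \<otimes> H\<^sub>4\<close> has a comultiplication with a component at \<open>1 \<otimes> g\<close>.\<close>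
  have gg: "f (h4e Bg) (h4e Bg) = hone A"
    using ex(2)[OF bilinear_comp_form[of Bgx Bg]] unfolding m by (simp add: sc eg G_def)
  have gx: "f (h4e Bg) (h4e Bx) = 0"
    using ex(2)[OF bilinear_comp_form[of B1 Bg]] unfolding m by (simp add: sc eg G_def)
  have xg: "f (h4e Bx) (h4e Bg) = 0"
    using ex(3)[OF bilinear_comp_form[of B1 Bg]] unfolding m by (simp add: sc eg G_def)
  have GG: "hmult ?P G G = axis B1 (hone A)" and GX: "hmult ?P G X = Y"
    and XG: "hmult ?P X G = - Y" and XX: "hmult ?P X X = axis B1 z"
    unfolding m gg gx xg Y_def by simp_all
  note assoc = P.mult_assoc
  have neg: "hmult ?P (- v) w = - hmult ?P v w" "hmult ?P v (- w) = - hmult ?P v w" for v w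
    by (rule P.mult_linear)+
  have GY: "hmult ?P G Y = X"
    using assoc[of G G X] by (simp add: GG GX one)
  have YG: "hmult ?P Y G = - X"
    using assoc[of G X G] by (simp add: GX XG GY neg)
  have Gz: "hmult ?P G (axis B1 z) = axis Bg z"
    by (simp add: G_def \<iota>')
  have YX: "hmult ?P Y X = axis Bg z"
    using assoc[of G X X] by (simp add: GX XX Gz)
  have XY: "hmult ?P X Y = - axis Bg z"
    using assoc[of X G X] by (simp add: GX XG YX neg)
  have YY: "hmult ?P Y Y = - axis B1 z"
    using assoc[of G X Y] assoc[of G G "axis B1 z"] by (simp add: GX XY Gz GG one neg)
  \<comment> \<open>\<open>x\<close> commutes with \<open>A\<close> because the action is trivial, hence so does \<open>z = x\<^sup>2\<close>.\<close>
  have "z \<in> center A"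
    unfolding center_def
  proof safe
    fix a
    have c: "hmult ?P X (axis B1 a) = hmult ?P (axis B1 a) X" for a
      by (simp add: X_def \<iota> \<iota>')
    have "hmult ?P (axis B1 z) (axis B1 a) = hmult ?P (axis B1 a) (axis B1 z)"
      using assoc[of X X "axis B1 a"] assoc[of X "axis B1 a" X] assoc[of "axis B1 a" X X]
      by (simp add: XX c)
    then have "axis B1 (hmult A z a) $ B1 = axis B1 (hmult A a z) $ B1"
      by (simp only: \<iota>)
    then show "hmult A z a = hmult A a z"
      by simp
  qed
  \<comment> \<open>The component of \<open>\<Delta>(x)\<^sup>2\<close> at \<open>1 \<otimes> 1\<close>.\<close>
  moreover have "z \<in> primitives A"
  proof (rule primitiveI_forms)
    fix \<psi> assume \<psi>: "bilinear_map (hscale A) (hscale A) (*) \<psi>"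
    have b: "bilinear_map (vscale A) (vscale A) (*) (\<lambda>v w. \<psi> (v $ B1) (w $ B1))"
      by (rule bilinear_comp[OF \<psi> linear_nth linear_nth])
    show "sw2 (*) A \<psi> z = \<psi> z (hone A) + \<psi> (hone A) z"
      using ex(4)[OF b] unfolding XX XG GX GG
      by (simp add: sw2_crossed_basis(1)[OF b] X_def bilinear_zero[OF \<psi>])
  qed
  moreover have "f = sq_cocycle A z"
  proof (rule bilinear_eqI_basis[OF bf])
    show "bilinear_map (*s) (*s) (hscale A) (sq_cocycle A z)"
      using bilinear_sq_cocycle by (simp add: H4_sel(1))
    show "f (h4e i) (h4e j) = sq_cocycle A z (h4e i) (h4e j)" for i j
      unfolding f_val[of i j] using GG GX XG XX GY YG YX XY YY
      by (cases i; cases j) (simp_all add: one flip: X_def Y_def G_def, simp_all add: X_def Y_def G_def sq_cocycle_def)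
  qed
  ultimately show ?thesis
    using triv(1) by (auto simp: ZP_def)
qed

end

section \<open>Isomorphisms between crossed products\<close>

lemma two_neq_zero_if_char_neq_2:
  assumes "CHAR('k::field) \<noteq> 2"
  shows "(2 :: 'k) \<noteq> 0"
proof
  assume "(2 :: 'k) = 0"
  then have "of_nat 2 = (0 :: 'k)"
    by simp
  then have "CHAR('k) dvd 2"
    by (simp only: of_nat_eq_0_iff_char_dvd)
  then have "CHAR('k) = 1 \<or> CHAR('k) = 2"
    using two_is_prime_nat by (auto simp: prime_nat_iff)
  then show False
    using assms by auto
qed

context hopf_algebra
begin

lemma hopf_hom_axis: "hopf_hom A (h4_ext A z) (axis B1)"
proof (rule hopf_homI_forms)
  fix \<phi> a assume "bilinear_map (hscale (h4_ext A z)) (hscale (h4_ext A z)) (*) \<phi>"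
  then show "sw2 (*) (h4_ext A z) \<phi> (axis B1 a) = sw2 (*) A (\<lambda>a1 a2. \<phi> (axis B1 a1) (axis B1 a2)) a"
    unfolding h4_ext_def by (intro sw2_crossed_basis(1)) simp
qed (simp_all add: linear_axis h4_ext_mult vec_eq_iff all_h4)

definition h4_proj :: "'a ^ h4 \<Rightarrow> 'k ^ h4"
  where "h4_proj v = (\<chi> i. hcounit A (v $ i))"

lemma hopf_hom_h4_proj:
  assumes z: "z \<in> ZP A"
  shows "hopf_hom (h4_ext A z) H4 h4_proj"
proof (rule hopf_homI_forms)
  have ez: "hcounit A z = 0"
    using z by (simp add: ZP_def counit_primitive)
  show "Vector_Spaces.linear (hscale (h4_ext A z)) (hscale H4) h4_proj"
    by (simp add: Vector_Spaces.linear_iff h4_proj_def H4_sel(1) vec_eq_iff vec.vector_space_axioms)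
  show "hcounit H4 (h4_proj v) = hcounit (h4_ext A z) v" for v
    by (simp add: h4_proj_def H4_sel UNIV_h4)
  show "h4_proj (hone (h4_ext A z)) = hone H4"
    by (simp add: h4_proj_def H4_sel vec_eq_iff all_h4)
  show "h4_proj (hmult (h4_ext A z) v w) = hmult H4 (h4_proj v) (h4_proj w)" for v w
    by (simp add: h4_proj_def h4_ext_mult ez H4_sel UNIV_h4 vec_eq_iff all_h4)
  fix \<phi> :: "'k ^ h4 \<Rightarrow> 'k ^ h4 \<Rightarrow> 'k" and v
  assume "bilinear_map (hscale H4) (hscale H4) (*) \<phi>"
  then have \<phi>: "\<phi> (c *s h) (d *s h') = c * (d * \<phi> h h')" for c d h h'
    by (simp add: bilinear_map_iff H4_sel(1))
  have p: "h4_proj (axis i a) = hcounit A a *s h4e i" for i a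
    by (simp add: h4_proj_def vec_eq_iff all_h4)
  have "sw2 (*) A (\<lambda>a b. hcounit A a * (hcounit A b * c)) d = hcounit A d * c" for c d
    by (rule sw2_counit) (simp add: Vector_Spaces.linear_iff vector_space_scalars algebra_simps)
  then show "sw2 (*) H4 \<phi> (h4_proj v) = sw2 (*) (h4_ext A z) (\<lambda>v1 v2. \<phi> (h4_proj v1) (h4_proj v2)) v"
    by (simp add: sw2_H4 sw2_h4_ext vector_space_scalars p \<phi>) (simp add: h4_proj_def algebra_simps)
qed

text \<open>The composite \<open>A \<rightarrow> h4_ext A b \<rightarrow> H\<^sub>4\<close> is trivial, so the image of \<open>A\<close> consists of coinvariants of the
  projection to \<open>H\<^sub>4\<close>: applying the projection to the first leg of \<open>\<Delta>(\<phi>(c))\<close> gives \<open>1 \<otimes> \<phi>(c)\<close>.  The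
  coefficients at \<open>g \<otimes> g\<close>, \<open>x \<otimes> 1\<close> and \<open>g x \<otimes> g\<close> show that only the component at \<open>1\<close> survives.\<close>

lemma hom_maps_base_to_base:
  assumes triv: "\<And>\<psi>. hopf_hom A (H4 :: ('k, 'k ^ h4) hopf) \<psi> \<Longrightarrow> \<psi> = trivial_hom A H4"
    and b: "b \<in> ZP A" and hom: "hopf_hom (h4_ext A a) (h4_ext A b) \<phi>"
  shows "\<phi> (axis B1 c) = axis B1 (\<phi> (axis B1 c) $ B1)"
proof -
  let ?u = "\<lambda>c. \<phi> (axis B1 c)"
  have u: "hopf_hom A (h4_ext A b) ?u"
    using hopf_hom_comp[OF hopf_hom_axis hom] by (simp add: o_def)
  have "hopf_hom A H4 (\<lambda>c. h4_proj (?u c))"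
    using hopf_hom_comp[OF u hopf_hom_h4_proj[OF b]] by (simp add: o_def)
  from fun_cong[OF triv[OF this]] have "h4_proj (?u c) = trivial_hom A H4 c" for c .
  then have eps: "hcounit A (?u c $ i) = (if i = B1 then hcounit A c else 0)" for c i
    by (simp add: vec_eq_iff h4_proj_def trivial_hom_def H4_sel)
  have lin: "Vector_Spaces.linear (hscale A) (hscale A) (\<lambda>c. ?u c $ j)" for j
    using hopf_homD(1)[OF u] by (simp add: Vector_Spaces.linear_iff)
  have "sw2 (hscale A) (h4_ext A b) (comp_form i j) (?u c) = (if i = B1 then ?u c $ j else 0)" for i j
    using hopf_hom_sw2[OF u, of "hscale A" "comp_form i j"] bilinear_comp_form
    by (simp add: comp_form_def eps sw2_fun_zero sw2_counit[OF lin])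
  from this[of Bg Bg] this[of Bx B1] this[of Bgx Bg] show ?thesis
    unfolding h4_ext_def by (simp add: sw2_comp_form vec_eq_iff all_h4)
qed

text \<open>Both \<open>\<phi>\<close> and its inverse map \<open>A\<close> to itself.  The last conclusion will show that \<open>\<phi>(g)\<close> and \<open>\<phi>(x)\<close>
  do not lie in \<open>A\<close>.\<close>

lemma iso_restricts_to_base:
  assumes triv: "\<And>\<psi>. hopf_hom A (H4 :: ('k, 'k ^ h4) hopf) \<psi> \<Longrightarrow> \<psi> = trivial_hom A H4"
    and a: "a \<in> ZP A" and b: "b \<in> ZP A" and iso: "hopf_iso (h4_ext A a) (h4_ext A b) \<phi>"
  obtains u where "u \<in> Aut_Hopf A" "\<And>c. \<phi> (axis B1 c) = axis B1 (u c)"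
    "\<And>v c. \<phi> v = axis B1 c \<Longrightarrow> v = axis B1 (v $ B1)"
proof -
  have hom: "hopf_hom (h4_ext A a) (h4_ext A b) \<phi>" and bij: "bij \<phi>"
    using iso by (auto simp: hopf_iso_def)
  have hom': "hopf_hom (h4_ext A b) (h4_ext A a) (inv \<phi>)"
    using hopf_iso_inv[OF iso] by (simp add: hopf_iso_def)
  have inv: "\<phi> (inv \<phi> v) = v" "inv \<phi> (\<phi> v) = v" for v
    using bij by (auto simp: bij_def surj_f_inv_f)
  define u u' where "u c = \<phi> (axis B1 c) $ B1" and "u' c = inv \<phi> (axis B1 c) $ B1" for c
  have u: "\<phi> (axis B1 c) = axis B1 (u c)" for c
    unfolding u_def by (rule hom_maps_base_to_base[OF triv b hom])
  have u': "inv \<phi> (axis B1 c) = axis B1 (u' c)" for c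
    unfolding u'_def by (rule hom_maps_base_to_base[OF triv a hom'])
  have base: "v = axis B1 (v $ B1)" if "\<phi> v = axis B1 c" for v c
  proof -
    have "v = axis B1 (u' c)"
      using inv(2)[of v] that u' by simp
    then show ?thesis
      by simp
  qed
  have hu: "hopf_hom A (h4_ext A b) (\<lambda>c. axis B1 (u c))"
    using hopf_hom_comp[OF hopf_hom_axis hom] by (simp add: o_def u)
  have eqI: "x = y" if "axis B1 x = (axis B1 y :: 'a ^ h4)" for x y
    using arg_cong[OF that, of "\<lambda>v. v $ B1"] by simp
  have "hopf_hom A A u"
  proof (rule hopf_homI_forms)
    show "Vector_Spaces.linear (hscale A) (hscale A) u"
      using hopf_homD(2,3)[OF hu] by (auto simp: Vector_Spaces.linear_iff intro!: eqI)
    show "u (hone A) = hone A" "u (hmult A x y) = hmult A (u x) (u y)" for x y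
      using hopf_homD(6)[OF hu] hopf_homD(7)[OF hu, of x y]
      by (auto simp: h4_ext_mult vec_eq_iff all_h4)
    show "hcounit A (u c) = hcounit A c" for c
      using hopf_homD(5)[OF hu, of c] by simp
    fix \<psi> c assume "bilinear_map (hscale A) (hscale A) (*) \<psi>"
    then have b: "bilinear_map (vscale A) (vscale A) (*) (\<lambda>v w. \<psi> (v $ B1) (w $ B1))"
      by (rule bilinear_comp[OF _ linear_nth linear_nth])
    have "sw2 (*) A \<psi> (u c) = sw2 (*) (h4_ext A b) (\<lambda>v w. \<psi> (v $ B1) (w $ B1)) (axis B1 (u c))"
      unfolding h4_ext_def by (simp add: sw2_crossed_basis(1)[OF b])
    also have "\<dots> = sw2 (*) A (\<lambda>a1 a2. \<psi> (u a1) (u a2)) c"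
      using hopf_hom_sw2[OF hu, of "(*)" "\<lambda>v w. \<psi> (v $ B1) (w $ B1)"] b by simp
    finally show "sw2 (*) A \<psi> (u c) = sw2 (*) A (\<lambda>a1 a2. \<psi> (u a1) (u a2)) c" .
  qed
  moreover have "u (u' c) = c" "u' (u c) = c" for c
    using inv(1)[of "axis B1 c"] inv(2)[of "axis B1 c"] by (auto simp: u u' intro: eqI)
  then have "bij u"
    by (intro o_bij[of u']) auto
  ultimately have "u \<in> Aut_Hopf A"
    by (simp add: Aut_Hopf_def hopf_iso_def)
  then show ?thesis
    using that u base by blast
qed

text \<open>Write \<open>\<gamma> = \<phi>(g)\<close> and \<open>w = \<phi>(x)\<close>, so \<open>\<Delta>(\<gamma>) = \<gamma> \<otimes> \<gamma>\<close> and \<open>\<Delta>(w) = w \<otimes> 1 + \<gamma> \<otimes> w\<close>.  Let \<open>p\<close> and \<open>q\<close>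
  be the projections of \<open>\<gamma>\<close> and \<open>w\<close> to \<open>H\<^sub>4\<close>.  Coefficients of these two equations show that \<open>p = g\<close>
  and that \<open>w\<close> is \<open>q\<^sub>1 + q\<^sub>x x\<close> up to its component at \<open>g\<close>.  By \<open>w \<gamma> = - \<gamma> w\<close> the scalars \<open>q\<^sub>1\<close> and
  \<open>q\<^sub>g\<close> vanish, and with \<open>q\<^sub>g\<close> the component at \<open>g\<close>, so \<open>w = q\<^sub>x x\<close>.\<close>

theorem iso_imp_ZP_rel:
  assumes char: "(2 :: 'k) \<noteq> 0"
    and triv: "\<And>\<psi>. hopf_hom A (H4 :: ('k, 'k ^ h4) hopf) \<psi> \<Longrightarrow> \<psi> = trivial_hom A H4"
    and a: "a \<in> ZP A" and b: "b \<in> ZP A" and iso: "hopf_iso (h4_ext A a) (h4_ext A b) \<phi>"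
  shows "(a, b) \<in> ZP_rel A"
proof -
  obtain u where u: "u \<in> Aut_Hopf A" "\<And>c. \<phi> (axis B1 c) = axis B1 (u c)"
      and base: "\<And>v c. \<phi> v = axis B1 c \<Longrightarrow> v = axis B1 (v $ B1)"
    using iso_restricts_to_base[OF triv a b iso] by blast
  have hom: "hopf_hom (h4_ext A a) (h4_ext A b) \<phi>"
    using iso by (simp add: hopf_iso_def)
  let ?Ea = "h4_ext A a" and ?Eb = "h4_ext A b"
  define G :: "'a ^ h4" where "G = axis Bg (hone A)"
  define X :: "'a ^ h4" where "X = axis Bx (hone A)"
  define \<gamma> where "\<gamma> = \<phi> G"
  define w where "w = \<phi> X"
  have one: "hone A \<noteq> 0"
    using counit_one by (metis counit_lin(5) zero_neq_one)
  have \<phi>_one: "\<phi> (axis B1 (hone A)) = axis B1 (hone A)"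
    using hopf_homD(6)[OF hom] by simp
  have hom_sw2: "sw2 t ?Eb \<psi> (\<phi> v) = sw2 t ?Ea (\<lambda>v1 v2. \<psi> (\<phi> v1) (\<phi> v2)) v"
      "bilinear_map (vscale A) (vscale A) t (\<lambda>v1 v2. \<psi> (\<phi> v1) (\<phi> v2))"
    if "bilinear_map (vscale A) (vscale A) t \<psi>" for t \<psi> v
  proof -
    show "sw2 t ?Eb \<psi> (\<phi> v) = sw2 t ?Ea (\<lambda>v1 v2. \<psi> (\<phi> v1) (\<phi> v2)) v"
      using that by (intro hopf_hom_sw2[OF hom]) simp
    have "Vector_Spaces.linear (vscale A) (vscale A) \<phi>"
      using hopf_homD(1)[OF hom] by simp
    then show "bilinear_map (vscale A) (vscale A) t (\<lambda>v1 v2. \<psi> (\<phi> v1) (\<phi> v2))"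
      by (intro bilinear_comp[OF that])
  qed
  have \<gamma>_sw2: "sw2 t ?Eb \<psi> \<gamma> = \<psi> \<gamma> \<gamma>"
    and w_sw2: "sw2 t ?Eb \<psi> w = \<psi> w (axis B1 (hone A)) + \<psi> \<gamma> w"
    if "bilinear_map (vscale A) (vscale A) t \<psi>" for t \<psi>
    unfolding \<gamma>_def w_def hom_sw2(1)[OF that] G_def X_def
    unfolding h4_ext_def[of A a] sw2_crossed_basis[OF hom_sw2(2)[OF that]] by (simp_all add: \<phi>_one)
  have comp: "sw2 (hscale A) ?Eb (comp_form i j) v =
    (case (i, j) of (B1, B1) \<Rightarrow> v $ B1 | (Bg, Bg) \<Rightarrow> v $ Bg | (Bx, B1) \<Rightarrow> v $ Bx | (Bg, Bx) \<Rightarrow> v $ Bx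
      | (Bgx, Bg) \<Rightarrow> v $ Bgx | (B1, Bgx) \<Rightarrow> v $ Bgx | _ \<Rightarrow> 0)" for i j v
    unfolding h4_ext_def by (rule sw2_comp_form)
  define p where "p i = hcounit A (\<gamma> $ i)" for i
  define q where "q i = hcounit A (w $ i)" for i
  have \<gamma>_comp: "sw2 (hscale A) ?Eb (comp_form i j) \<gamma> = hscale A (p i) (\<gamma> $ j)" for i j
    unfolding \<gamma>_sw2[OF bilinear_comp_form] by (simp add: comp_form_def p_def)
  have p_sum: "p B1 + p Bg = 1"
    using hopf_homD(5)[OF hom, of G] by (simp add: p_def \<gamma>_def G_def)
  have "hscale A (p B1) (\<gamma> $ Bg) = 0"
    using \<gamma>_comp[of B1 Bg] by (simp only: comp) simp
  then have "hcounit A (hscale A (p B1) (\<gamma> $ Bg)) = hcounit A 0"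
    by (simp only:)
  then have "p B1 * p Bg = 0"
    by (simp only: counit_lin p_def)
  \<comment> \<open>Otherwise \<open>p = 1\<close>, \<open>\<gamma>\<close> lies in \<open>A\<close>, and then so does \<open>g\<close>.\<close>
  moreover have "p Bg \<noteq> 0"
  proof
    assume "p Bg = 0"
    then have "p B1 = 1"
      using p_sum by simp
    then have "\<gamma> $ Bg = 0" "\<gamma> $ Bx = 0" "\<gamma> $ Bgx = 0"
      using \<gamma>_comp[of B1 Bg] \<gamma>_comp[of B1 Bx] \<gamma>_comp[of Bgx Bg] by (simp_all add: comp)
    then have "\<phi> G = axis B1 (\<gamma> $ B1)"
      by (simp add: vec_eq_iff all_h4 flip: \<gamma>_def)
    then have "G = axis B1 (G $ B1)"
      by (rule base)
    then show False
      using one by (simp add: G_def vec_eq_iff all_h4)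
  qed
  ultimately have p1: "p B1 = 0" and pg: "p Bg = 1"
    using p_sum by auto
  have \<gamma>: "\<gamma> $ B1 = 0" "\<gamma> $ Bx = 0" "\<gamma> $ Bgx = 0"
    using \<gamma>_comp[of Bg B1] \<gamma>_comp[of Bx B1] \<gamma>_comp[of Bg Bgx] by (simp_all add: comp pg)
  have w_comp: "sw2 (hscale A) ?Eb (comp_form i j) w =
      hscale A (q i) (axis B1 (hone A) $ j) + hscale A (p i) (w $ j)" for i j
    unfolding w_sw2[OF bilinear_comp_form] by (simp add: comp_form_def p_def q_def)
  have w1: "w $ B1 = hscale A (q B1) (hone A)" and wx: "w $ Bx = hscale A (q Bx) (hone A)"
    and wgx: "w $ Bgx = 0"
    using w_comp[of B1 B1] w_comp[of Bx B1] w_comp[of B1 Bgx] \<gamma>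
    by (simp_all add: comp p1) (simp add: p_def)
  have anti: "hmult ?Eb w \<gamma> = - hmult ?Eb \<gamma> w"
  proof -
    have "hmult ?Ea X G = - hmult ?Ea G X"
      by (simp add: X_def G_def h4_ext_mult vec_eq_iff all_h4)
    then have "\<phi> (hmult ?Ea X G) = \<phi> (- hmult ?Ea G X)"
      by simp
    then show ?thesis
      by (simp only: hopf_homD(4,7)[OF hom] w_def \<gamma>_def)
  qed
  have "hcounit A (hmult ?Eb w \<gamma> $ i) = - hcounit A (hmult ?Eb \<gamma> w $ i)" for i
    by (simp add: anti)
  from this[of B1] this[of Bg] have "2 * q Bg = 0" "2 * q B1 = 0"
    using pg by (simp_all add: h4_ext_mult \<gamma> wgx q_def p_def eq_neg_iff_add_eq_0)
  \<comment> \<open>The group-like \<open>g\<close> commutes with \<open>1\<close> and \<open>g\<close>, so anticommutation doubles their coefficients.\<close>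
  then have qg: "q Bg = 0" and q1: "q B1 = 0"
    using char by simp_all
  \<comment> \<open>Projecting the first leg says nothing about the component of \<open>w\<close> at \<open>g\<close>; projecting the second
    leg identifies it with \<open>q\<^sub>g \<gamma>\<close>.\<close>
  have wg: "w $ Bg = 0"
  proof -
    have "bilinear_map (vscale A) (vscale A) (hscale A) (\<lambda>v v'. hscale A (hcounit A (v' $ Bg)) (v $ Bg))"
      by (rule bilinear_flip[OF bilinear_comp_form[of Bg Bg, unfolded comp_form_def]])
    from w_sw2[OF this] show ?thesis
      using qg by (simp add: sw2_h4_ext sw2_fun_zero q_def)
  qed
  define \<beta> where "\<beta> = q Bx"
  have w: "w = axis Bx (hscale A \<beta> (hone A))"
    by (simp add: vec_eq_iff all_h4 w1 wx wg wgx q1 \<beta>_def)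
  have "\<beta> \<noteq> 0"
  proof
    assume "\<beta> = 0"
    then have "\<phi> X = axis B1 0"
      using w by (simp add: w_def)
    then have "X = axis B1 (X $ B1)"
      by (rule base)
    then show False
      using one by (simp add: X_def vec_eq_iff all_h4)
  qed
  moreover have "u a = hscale A (\<beta>\<^sup>2) b"
  proof -
    have "hmult ?Ea X X = axis B1 a"
      by (simp add: X_def h4_ext_mult vec_eq_iff all_h4)
    then have "axis B1 (u a) = hmult ?Eb w w"
      using hopf_homD(7)[OF hom, of X X] u(2) by (simp add: w_def)
    also have "\<dots> = axis B1 (hscale A (\<beta>\<^sup>2) b)"
      by (simp add: w h4_ext_mult vec_eq_iff all_h4 power2_eq_square)
    finally show ?thesis
      by (metis axis_h4)
  qed
  ultimately show ?thesis
    using u(1) a b by (auto simp: ZP_rel_def)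
qed

text \<open>Conversely, rescaling \<open>x\<close> by \<open>\<beta>\<close> compensates for the factor \<open>\<beta>\<^sup>2\<close> in \<open>x\<^sup>2\<close>.\<close>

theorem ZP_rel_imp_iso:
  assumes "(a, b) \<in> ZP_rel A"
  shows "\<exists>\<phi>. hopf_iso (h4_ext A a) (h4_ext A b) \<phi>"
proof -
  obtain u \<beta> where a: "a \<in> ZP A" and b: "b \<in> ZP A" and u: "hopf_iso A A u" and \<beta>: "\<beta> \<noteq> 0"
    and ua: "u a = hscale A (\<beta>\<^sup>2) b"
    using assms by (auto simp: ZP_rel_def Aut_Hopf_def)
  have hom: "hopf_hom A A u" and bij: "bij u"
    using u by (auto simp: hopf_iso_def)
  define \<phi> where "\<phi> v = (\<chi> i. case i of B1 \<Rightarrow> u (v $ B1) | Bg \<Rightarrow> u (v $ Bg)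
    | Bx \<Rightarrow> hscale A \<beta> (u (v $ Bx)) | Bgx \<Rightarrow> hscale A \<beta> (u (v $ Bgx)))" for v :: "'a ^ h4"
  note lin = hopf_homD(2-4)[OF hom]
  have u0: "u 0 = 0"
    using lin(1)[of 0 0] by simp
  have diff: "u (x - y) = u x - u y" for x y
    using lin(1)[of x "- y"] lin(3) by simp
  have "hopf_hom (h4_ext A a) (h4_ext A b) \<phi>"
  proof (rule hopf_homI_forms)
    show "Vector_Spaces.linear (hscale (h4_ext A a)) (hscale (h4_ext A b)) \<phi>"
      by (simp add: Vector_Spaces.linear_iff \<phi>_def vec_eq_iff all_h4 lin V.scale_right_distrib mult.commute)
    show "hcounit (h4_ext A b) (\<phi> v) = hcounit (h4_ext A a) v" for v
      by (simp add: \<phi>_def hopf_homD(5)[OF hom])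
    show "\<phi> (hone (h4_ext A a)) = hone (h4_ext A b)"
      by (simp add: \<phi>_def vec_eq_iff all_h4 hopf_homD(6)[OF hom] u0)
    show "\<phi> (hmult (h4_ext A a) v w) = hmult (h4_ext A b) (\<phi> v) (\<phi> w)" for v w
      by (simp add: \<phi>_def h4_ext_mult vec_eq_iff all_h4 lin diff hopf_homD(7)[OF hom] ua power2_eq_square
          V.scale_right_distrib V.scale_right_diff_distrib)
    fix \<psi> v assume "bilinear_map (hscale (h4_ext A b)) (hscale (h4_ext A b)) (*) \<psi>"
    then have \<psi>: "bilinear_map (vscale A) (vscale A) (*) \<psi>"
      by simp
    then have s: "\<psi> (vscale A c x) y = c * \<psi> x y" "\<psi> x (vscale A c y) = c * \<psi> x y" for c x y
      by (simp_all add: bilinear_map_iff)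
    have ax: "\<phi> (axis B1 c) = axis B1 (u c)" "\<phi> (axis Bg c) = axis Bg (u c)"
      "\<phi> (axis Bx c) = vscale A \<beta> (axis Bx (u c))" "\<phi> (axis Bgx c) = vscale A \<beta> (axis Bgx (u c))" for c
      by (simp_all add: \<phi>_def vec_eq_iff all_h4 u0)
    note bil = bilinear_axis[OF \<psi>]
    show "sw2 (*) (h4_ext A b) \<psi> (\<phi> v) = sw2 (*) (h4_ext A a) (\<lambda>v1 v2. \<psi> (\<phi> v1) (\<phi> v2)) v"
      unfolding sw2_h4_ext[OF vector_space_scalars] ax s
      by (simp add: sw2_fun_scale[OF vector_space_scalars] hopf_hom_sw2[OF hom bil, symmetric])
        (simp add: \<phi>_def sw2_linear[OF bil])
  qed
  moreover have "bij \<phi>"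
  proof (rule bijI)
    show "inj \<phi>"
      using \<beta> bij by (auto intro!: injI simp: \<phi>_def vec_eq_iff all_h4 bij_def inj_eq)
    show "surj \<phi>"
    proof (rule surjI)
      fix v
      have "u (inv u c) = c" for c
        using bij by (simp add: bij_def surj_f_inv_f)
      then show "\<phi> (\<chi> i. case i of B1 \<Rightarrow> inv u (v $ B1) | Bg \<Rightarrow> inv u (v $ Bg)
          | Bx \<Rightarrow> inv u (hscale A (1 / \<beta>) (v $ Bx)) | Bgx \<Rightarrow> inv u (hscale A (1 / \<beta>) (v $ Bgx))) = v"
        using \<beta> by (simp add: \<phi>_def vec_eq_iff all_h4)
    qed
  qed
  ultimately show ?thesis
    by (auto simp: hopf_iso_def)
qed

end

section \<open>Equivalence of crossed systems\<close>

context hopf_algebra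
begin

lemma sw3_counit:
  assumes \<psi>: "Vector_Spaces.linear (hscale A) t \<psi>"
  shows "sw3 t A (\<lambda>a1 a2 a3. t (hcounit A a1 * hcounit A a3) (\<psi> a2)) a = \<psi> a"
proof -
  have T: "vector_space t"
    using \<psi> by (simp add: Vector_Spaces.linear_iff)
  interpret T: vector_space t by fact
  have "sw2 t A (\<lambda>a2 a3. t (c * hcounit A a3) (\<psi> a2)) b = t c (\<psi> b)" for c b
    using sw2_fun_scale[OF T, of A c "\<lambda>a2 a3. t (hcounit A a3) (\<psi> a2)" b] sw2_counit(2)[OF \<psi>] by simp
  then show ?thesis
    by (simp add: sw3_def sw2_counit(1)[OF \<psi>])
qed

lemma sw4_counit:
  assumes \<psi>: "Vector_Spaces.linear (hscale A) t \<psi>"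
  shows "sw4 t A (\<lambda>a1 a2 a3 a4. t (hcounit A a1 * hcounit A a2 * hcounit A a4) (\<psi> a3)) a = \<psi> a"
proof -
  have T: "vector_space t"
    using \<psi> by (simp add: Vector_Spaces.linear_iff)
  interpret T: vector_space t by fact
  have "sw3 t A (\<lambda>a2 a3 a4. t (c * hcounit A a2 * hcounit A a4) (\<psi> a3)) b = t c (\<psi> b)" for c b
  proof -
    have "Vector_Spaces.linear (hscale A) t (\<lambda>a. t c (\<psi> a))"
      using \<psi> by (simp add: Vector_Spaces.linear_iff T.scale_right_distrib mult.commute)
    from sw3_counit[OF this, of b] show ?thesis
      by (simp add: mult_ac)
  qed
  then show ?thesis
    by (simp add: sw4_def sw2_counit(1)[OF \<psi>])
qed

lemma hopf_hom_trivial_H4: "hopf_hom H4 A (trivial_hom H4 A)"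
proof (rule hopf_homI_forms)
  interpret H: hopf_algebra "H4 :: ('k, 'k ^ h4) hopf" by (rule hopf_algebra_H4)
  show "Vector_Spaces.linear (hscale H4) (hscale A) (trivial_hom H4 A)"
    by (simp add: Vector_Spaces.linear_iff trivial_hom_def V.scale_left_distrib)
  fix \<phi> and h :: "'k ^ h4" assume bil: "bilinear_map (hscale A) (hscale A) (*) \<phi>"
  then have s: "\<phi> (hscale A c a) b = c * \<phi> a b" "\<phi> a (hscale A c b) = c * \<phi> a b" for a b c
    by (simp_all add: bilinear_map_iff)
  have "sw2 (*) H4 (\<lambda>h1 h2. hcounit H4 h1 * (hcounit H4 h2 * \<phi> (hone A) (hone A))) h =
      hcounit H4 h * \<phi> (hone A) (hone A)"
    by (rule H.sw2_counit) (simp add: Vector_Spaces.linear_iff vector_space_scalars algebra_simps)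
  then show "sw2 (*) A \<phi> (trivial_hom H4 A h) =
      sw2 (*) H4 (\<lambda>h1 h2. \<phi> (trivial_hom H4 A h1) (trivial_hom H4 A h2)) h"
    by (simp add: trivial_hom_def sw2_linear[OF bil] sw2_one[OF bil] s mult_ac)
next
  interpret H: hopf_algebra "H4 :: ('k, 'k ^ h4) hopf" by (rule hopf_algebra_H4)
  show "trivial_hom H4 A (hone H4) = hone A" "hcounit A (trivial_hom H4 A h) = hcounit H4 h"
    "trivial_hom H4 A (hmult H4 h h') = hmult A (trivial_hom H4 A h) (trivial_hom H4 A h')" for h h'
    by (simp_all add: trivial_hom_def)
qed

text \<open>For \<open>h = x\<close> the cocentrality condition reads \<open>r(x) \<otimes> 1 + r(g) \<otimes> x = r(1) \<otimes> x + r(x) \<otimes> g\<close>, whence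
  \<open>r(x) = 0\<close> and \<open>r(g) = r(1) = 1\<close>; for \<open>h = g x\<close> it gives \<open>r(g x) = 0\<close>.\<close>

lemma unitary_cocentral_H4_iff: "unitary_cocentral H4 A r \<longleftrightarrow> r = trivial_hom H4 A"
proof -
  have cocentral: "tensor_eq (hscale A) (hscale H4)
      (sw2 fscale H4 (\<lambda>h1 h2. r h1 \<otimes> h2) h) (sw2 fscale H4 (\<lambda>h1 h2. r h2 \<otimes> h1) h) \<longleftrightarrow>
    sw2 (vscale A) H4 (\<lambda>h1 h2. cten A (r h1) h2) h = sw2 (vscale A) H4 (\<lambda>h1 h2. cten A (r h2) h1) h" for r h
    by (simp add: H4_sel(1) tensor_eq_iff_vec fsum_sw2 fsum_single)
  have ecomp: "hcounit H4 (h4e i) = h4_counit i" for i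
    by (cases i) (simp_all add: H4_sel UNIV_h4)
  show ?thesis
  proof
    assume r: "unitary_cocentral H4 A r"
    then have lin: "r (x + y) = r x + r y" "r (c *s x) = hscale A c (r x)" for x y c
      by (simp_all add: unitary_cocentral_def coalgebra_map_def Vector_Spaces.linear_iff H4_sel(1))
    have r1: "r (h4e B1) = hone A"
      using r by (simp add: unitary_cocentral_def H4_sel(2))
    have c: "sw2 (vscale A) H4 (\<lambda>h1 h2. cten A (r h1) h2) h = sw2 (vscale A) H4 (\<lambda>h1 h2. cten A (r h2) h1) h" for h
      using r cocentral by (simp add: unitary_cocentral_def)
    have v: "r (h4e Bx) = 0" "r (h4e Bg) = hone A" "r (h4e Bgx) = 0"
      using c[of "h4e Bx"] c[of "h4e Bgx"] by (simp_all add: sw2_H4 r1 vec_eq_iff all_h4)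
    show "r = trivial_hom H4 A"
    proof
      fix h
      have "r h = r (h $ B1 *s h4e B1 + h $ Bg *s h4e Bg + h $ Bx *s h4e Bx + h $ Bgx *s h4e Bgx)"
        by (rule arg_cong[where f = r]) (simp add: vec_eq_iff all_h4)
      then show "r h = trivial_hom H4 A h"
        by (simp only: lin r1 v) (simp add: trivial_hom_def H4_sel(5) UNIV_h4 V.scale_left_distrib)
    qed
  next
    assume "r = trivial_hom H4 A"
    moreover have "tensor_eq (hscale A) (hscale H4)
        (sw2 fscale H4 (\<lambda>h1 h2. trivial_hom H4 A h1 \<otimes> h2) h)
        (sw2 fscale H4 (\<lambda>h1 h2. trivial_hom H4 A h2 \<otimes> h1) h)" for h
      unfolding cocentral by (simp add: sw2_H4 trivial_hom_def ecomp vec_eq_iff all_h4)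
    ultimately show "unitary_cocentral H4 A r"
      using hopf_homD(6,8)[OF hopf_hom_trivial_H4] by (simp add: unitary_cocentral_def)
  qed
qed

text \<open>With \<open>r = \<epsilon> 1\<close> all factors but one collapse by the counit laws, so modifying a crossed system by the
  trivial \<open>r\<close> does not change it.\<close>

lemma trivial_coboundary:
  assumes "(act, f) \<in> CS A H4"
  defines "r \<equiv> trivial_hom H4 A"
  shows "sw3 (hscale A) H4 (\<lambda>h1 h2 h3. hmult A (hmult A (r h1) (act h2 a)) (antipode A (r h3))) h = act h a"
    and "sw4 (hscale A) H4 (\<lambda>h1 h2 h3 h4.
           sw3 (hscale A) H4 (\<lambda>g1 g2 g3.
             hmult A (hmult A (hmult A (r h1) (act h2 (r g1))) (f h3 g2))
               (antipode A (r (hmult H4 h4 g3)))) g) h = f h g"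
proof -
  interpret H: hopf_algebra "H4 :: ('k, 'k ^ h4) hopf" by (rule hopf_algebra_H4)
  have act: "weak_action H4 A act" and f: "bilinear_map (hscale H4) (hscale H4) (hscale A) f"
    using assms by (auto simp: CS_def crossed_system_def)
  have act_one: "act h (hscale A c (hone A)) = hscale A (c * hcounit H4 h) (hone A)" for h c
    using act by (simp add: weak_action_def bilinear_map_iff)
  have la: "Vector_Spaces.linear (hscale H4) (hscale A) (\<lambda>h. act h a)"
    using act by (simp add: weak_action_def bilinear_map_def)
  show "sw3 (hscale A) H4 (\<lambda>h1 h2 h3. hmult A (hmult A (r h1) (act h2 a)) (antipode A (r h3))) h = act h a"
    using H.sw3_counit[OF la, of h] by (simp add: r_def trivial_hom_def antipode_scale_one mult.commute)
  have l1: "Vector_Spaces.linear (hscale H4) (hscale A) (\<lambda>g. hscale A c (f h3 g))" for c h3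
    using f by (simp add: bilinear_map_iff Vector_Spaces.linear_iff V.scale_right_distrib mult.commute)
  have l2: "Vector_Spaces.linear (hscale H4) (hscale A) (\<lambda>h. f h g)"
    using f by (simp add: bilinear_map_def)
  have "sw3 (hscale A) H4 (\<lambda>g1 g2 g3. hmult A (hmult A (hmult A (r h1) (act h2 (r g1))) (f h3 g2))
      (antipode A (r (hmult H4 h4 g3)))) g =
    hscale A (hcounit H4 h1 * hcounit H4 h2 * hcounit H4 h4) (f h3 g)" for h1 h2 h3 h4
    using H.sw3_counit[OF l1, of "hcounit H4 h1 * hcounit H4 h2 * hcounit H4 h4" h3 g]
    by (simp add: r_def trivial_hom_def act_one antipode_scale_one mult_ac)
  then show "sw4 (hscale A) H4 (\<lambda>h1 h2 h3 h4.
           sw3 (hscale A) H4 (\<lambda>g1 g2 g3.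
             hmult A (hmult A (hmult A (r h1) (act h2 (r g1))) (f h3 g2))
               (antipode A (r (hmult H4 h4 g3)))) g) h = f h g"
    by (simp only: H.sw4_counit[OF l2])
qed

lemma CS_rel_H4: "CS_rel A H4 = Id_on (CS A H4)"
proof -
  have "p = q" if pq: "(p, q) \<in> CS_rel A H4" for p q
  proof -
    obtain act f act' f' where p: "p = (act, f)" and q: "q = (act', f')"
      by (metis surj_pair)
    have cs: "(act, f) \<in> CS A H4"
      using pq unfolding p q CS_rel_def by blast
    obtain r where "unitary_cocentral H4 A r" and
      "\<forall>h a. act' h a =
         sw3 (hscale A) H4 (\<lambda>h1 h2 h3. hmult A (hmult A (r h1) (act h2 a)) (antipode A (r h3))) h"
      "\<forall>h g. f' h g =
         sw4 (hscale A) H4 (\<lambda>h1 h2 h3 h4.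
           sw3 (hscale A) H4 (\<lambda>g1 g2 g3.
             hmult A (hmult A (hmult A (r h1) (act h2 (r g1))) (f h3 g2))
               (antipode A (r (hmult H4 h4 g3)))) g) h"
      using pq unfolding p q CS_rel_def by blast
    then show "p = q"
      unfolding unitary_cocentral_H4_iff p q using trivial_coboundary[OF cs] by (simp add: fun_eq_iff)
  qed
  moreover have "(p, p) \<in> CS_rel A H4" if "p \<in> CS A H4" for p
  proof -
    obtain act f where p: "p = (act, f)"
      by (metis surj_pair)
    show ?thesis
      using that trivial_coboundary[of act f] unfolding p CS_rel_def
      by (auto simp: unitary_cocentral_H4_iff)
  qed
  moreover have "CS_rel A H4 \<subseteq> CS A H4 \<times> CS A H4"
    by (auto simp: CS_rel_def)
  ultimately show ?thesis
    by fast
qed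

lemma bij_betw_ZP_CS: "bij_betw (\<lambda>z. (triv_act A, sq_cocycle A z)) (ZP A) (CS A H4)"
proof (rule bij_betw_imageI)
  show "inj_on (\<lambda>z. (triv_act A, sq_cocycle A z)) (ZP A)"
  proof (rule inj_onI)
    fix y z assume "(triv_act A, sq_cocycle A y) = (triv_act A, sq_cocycle A z)"
    then have "sq_cocycle A y (h4e Bx) (h4e Bx) = sq_cocycle A z (h4e Bx) (h4e Bx)"
      by simp
    then show "y = z"
      by (simp add: sq_cocycle_def)
  qed
  show "(\<lambda>z. (triv_act A, sq_cocycle A z)) ` ZP A = CS A H4"
    using crossed_system_sq_cocycle crossed_system_classification
    by (fastforce simp: CS_def)
qed

theorem H2_H4_bij: "\<exists>G. bij_betw G (H2 H4 A) (ZP A)"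
proof -
  have "bij_betw (\<lambda>p. {p}) (CS A H4) (H2 H4 A)"
    by (rule bij_betw_imageI) (auto simp: H2_def CS_rel_H4 quotient_def)
  from bij_betw_trans[OF bij_betw_ZP_CS this] show ?thesis
    using bij_betw_inv by blast
qed

theorem equiv_ZP_rel: "equiv (ZP A) (ZP_rel A)"
proof (rule equivI)
  show "ZP_rel A \<subseteq> ZP A \<times> ZP A"
    by (auto simp: ZP_rel_def)
  show "refl_on (ZP A) (ZP_rel A)"
  proof (rule refl_onI)
    fix a assume "a \<in> ZP A"
    moreover have "id \<in> Aut_Hopf A"
      using hopf_iso_id[OF hopf_algebra_axioms] by (simp add: Aut_Hopf_def)
    ultimately show "(a, a) \<in> ZP_rel A"
      by (force simp: ZP_rel_def intro!: bexI[of _ id] exI[of _ 1])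
  qed
  show "sym (ZP_rel A)"
  proof (rule symI)
    fix a b assume "(a, b) \<in> ZP_rel A"
    then obtain u \<beta> where ab: "a \<in> ZP A" "b \<in> ZP A" and u: "hopf_iso A A u" and \<beta>: "\<beta> \<noteq> 0"
        and ua: "u a = hscale A (\<beta>\<^sup>2) b"
      by (auto simp: ZP_rel_def Aut_Hopf_def)
    have inv: "hopf_iso A A (inv u)"
      by (rule hopf_iso_inv[OF u])
    have "inv u (hscale A (\<beta>\<^sup>2) b) = a"
      using u by (simp add: hopf_iso_def bij_is_inj flip: ua)
    then have "hscale A (\<beta>\<^sup>2) (inv u b) = a"
      using inv hopf_homD(3)[of A A "inv u"] by (simp add: hopf_iso_def)
    then have "hscale A ((1 / \<beta>)\<^sup>2) a = inv u b"
      using \<beta> by (auto simp: power_divide)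
    then show "(b, a) \<in> ZP_rel A"
      using ab inv \<beta> by (auto simp: ZP_rel_def Aut_Hopf_def intro!: bexI[of _ "inv u"] exI[of _ "1 / \<beta>"])
  qed
  show "trans (ZP_rel A)"
  proof (rule transI)
    fix a b c assume "(a, b) \<in> ZP_rel A" "(b, c) \<in> ZP_rel A"
    then obtain u \<beta> v \<gamma> where abc: "a \<in> ZP A" "c \<in> ZP A"
        and u: "hopf_iso A A u" "\<beta> \<noteq> 0" "u a = hscale A (\<beta>\<^sup>2) b"
        and v: "hopf_iso A A v" "\<gamma> \<noteq> 0" "v b = hscale A (\<gamma>\<^sup>2) c"
      by (auto simp: ZP_rel_def Aut_Hopf_def)
    have "(v \<circ> u) a = hscale A ((\<beta> * \<gamma>)\<^sup>2) c"
      using v(1) hopf_homD(3)[of A A v] by (simp add: u(3) v(3) hopf_iso_def power_mult_distrib)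
    then show "(a, c) \<in> ZP_rel A"
      using abc hopf_iso_comp[OF u(1) v(1)] u(2) v(2)
      by (auto simp: ZP_rel_def Aut_Hopf_def intro!: bexI[of _ "v \<circ> u"] exI[of _ "\<beta> * \<gamma>"])
  qed
qed

end

text \<open>Since \<open>R\<close> is the pullback of \<open>S\<close>, taking preimages under \<open>p\<close> sends the class of \<open>p a\<close> to the class
  of \<open>a\<close>, and taking images undoes this.\<close>

lemma bij_betw_quotient_pullback:
  assumes R: "R \<subseteq> M \<times> M" and S: "S \<subseteq> p ` M \<times> p ` M"
    and iff: "\<And>a b. a \<in> M \<Longrightarrow> b \<in> M \<Longrightarrow> (p a, p b) \<in> S \<longleftrightarrow> (a, b) \<in> R"
  shows "bij_betw (\<lambda>Q. {a \<in> M. p a \<in> Q}) (p ` M // S) (M // R)"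
proof (rule bij_betw_byWitness[where f' = "(`) p"])
  have img: "S `` {p a} = p ` (R `` {a})" if "a \<in> M" for a
    using that R S iff by fastforce
  have pre: "{c \<in> M. p c \<in> S `` {p a}} = R `` {a}" if "a \<in> M" for a
    using that R iff by auto
  have quot: "p ` M // S = (\<lambda>a. S `` {p a}) ` M" "M // R = (\<lambda>a. R `` {a}) ` M"
    by (auto simp: quotient_def)
  show "\<forall>Q\<in>p ` M // S. p ` {a \<in> M. p a \<in> Q} = Q"
  proof
    fix Q assume "Q \<in> p ` M // S"
    then obtain a where "a \<in> M" "Q = S `` {p a}"
      unfolding quot by blast
    then show "p ` {a \<in> M. p a \<in> Q} = Q"
      by (simp only: pre) (simp only: img)
  qed
  show "\<forall>Q\<in>M // R. {a \<in> M. p a \<in> p ` Q} = Q"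
  proof
    fix Q assume "Q \<in> M // R"
    then obtain a where "a \<in> M" "Q = R `` {a}"
      unfolding quot by blast
    then show "{a \<in> M. p a \<in> p ` Q} = Q"
      by (simp only: pre flip: img)
  qed
  show "(\<lambda>Q. {a \<in> M. p a \<in> Q}) ` (p ` M // S) \<subseteq> M // R"
  proof (rule image_subsetI)
    fix Q assume "Q \<in> p ` M // S"
    then obtain a where "a \<in> M" "Q = S `` {p a}"
      unfolding quot by blast
    then show "{a \<in> M. p a \<in> Q} \<in> M // R"
      unfolding quot by (simp only: pre) (rule imageI)
  qed
  show "(`) p ` (M // R) \<subseteq> p ` M // S"
  proof (rule image_subsetI)
    fix Q assume "Q \<in> M // R"
    then obtain a where "a \<in> M" "Q = R `` {a}"
      unfolding quot by blast
    then show "p ` Q \<in> p ` M // S"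
      unfolding quot by (simp only: img[symmetric]) (rule imageI)
  qed
qed

theorem theorem3p7:
  fixes A :: "('k::field, 'a::ab_group_add) hopf"
  assumes "CHAR('k) \<noteq> 2"
    and "hopf_algebra A"
    and "\<And>\<phi>. hopf_hom A (H4 :: ('k, 'k ^ h4) hopf) \<phi> \<Longrightarrow> \<phi> = trivial_hom A H4"
  shows "(equiv (ZP A) (ZP_rel A) \<and>
          (\<exists>F. bij_betw F (Crp (H4 :: ('k, 'k ^ h4) hopf) A) (ZP A // ZP_rel A))) \<and>
         (\<exists>G. bij_betw G (H2 (H4 :: ('k, 'k ^ h4) hopf) A) (ZP A))"
proof -
  interpret hopf_algebra A by fact
  have "{crossed_product A (H4 :: ('k, 'k ^ h4) hopf) act f | act f. crossed_system A H4 act f} = h4_ext A ` ZP A"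
    using crossed_system_classification crossed_system_sq_cocycle unfolding h4_ext_def by blast
  then have Crp: "Crp (H4 :: ('k, 'k ^ h4) hopf) A =
    h4_ext A ` ZP A // {(X, Y). X \<in> h4_ext A ` ZP A \<and> Y \<in> h4_ext A ` ZP A \<and> (\<exists>\<phi>. hopf_iso X Y \<phi>)}"
    by (simp add: Crp_def)
  have "bij_betw (\<lambda>Q. {a \<in> ZP A. h4_ext A a \<in> Q}) (Crp (H4 :: ('k, 'k ^ h4) hopf) A) (ZP A // ZP_rel A)"
    unfolding Crp
  proof (rule bij_betw_quotient_pullback)
    fix a b assume ab: "a \<in> ZP A" "b \<in> ZP A"
    show "(h4_ext A a, h4_ext A b) \<in> {(X, Y). X \<in> h4_ext A ` ZP A \<and> Y \<in> h4_ext A ` ZP A \<and>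
        (\<exists>\<phi>. hopf_iso X Y \<phi>)} \<longleftrightarrow> (a, b) \<in> ZP_rel A"
      using ab iso_imp_ZP_rel[OF two_neq_zero_if_char_neq_2[OF assms(1)] assms(3) ab] ZP_rel_imp_iso[of a b] by auto
  qed (auto simp: ZP_rel_def)
  then show ?thesis
    using equiv_ZP_rel H2_H4_bij by blast
qed

end
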